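(* Let $\{X^I\}_{I\in\mathcal{I}}$ be a family of processes satisfying conditions (i)–(v) of the context. Then there is $\sigma\ge0$ such that for every $I\in\mathcal{I}$, $X^I$ has the law of $\sigma$ times a Brownian bridge on $I$ from $0$ to $0$.
   Context: $\mathcal{I}$ is the set of closed bounded intervals of $\mathbb{R}$. For each $I\in\mathcal{I}$, $X^I=(X^I(t))_{t\in I}$ is a real stochastic process (law on $\mathbb{R}^I$ with the product topology). Assume: (i) (Tails) $\mathbb{E}[\log^+|X^I(t)|]<\infty$ for all $I$ and $t\in I$. (ii) (Stochastic continuity) $\lim_{s\to t}\mathbb{P}(|X^I(t)-X^I(s)|>\varepsilon)=0$ for all $\varepsilon>0$, $t\in I$. (iii) (Zero boundary) $X^{[a,b]}(a)=X^{[a,b]}(b)=0$. (iv) (Domain Markov) For $I'=[a,b]\subset I$, conditionally on $(X^I(t))_{t\in I\setminus I'}$, the law of $(X^I(s))_{s\in I'}$ is that of $L(s)+\tilde X^{I'}(s)$, $s\in I'$, where $L$ is the linear function interpolating between $X^I(a)$ and $X^I(b)$ and $\tilde X^{I'}$ is an independent copy of $X^{I'}$. (v) (Translation invariance and scaling) For $a\in\mathbb{R}$, $c>0$: $(X^{I-a}(t-a))_{t\in I}\overset{(d)}{=}(X^I(t))_{t\in I}$ and $(c^{-1/2}X^{cI}(ct))_{t\in I}\overset{(d)}{=}(X^I(t))_{t\in I}$. *)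

theory Defs
  imports "HOL-Probability.Probability"
begin

text \<open>Processes indexed by a closed bounded interval {a..b} (a \<le> b) are represented by their
laws, i.e. probability measures on the product space (PiM {a..b} (\<lambda>_. borel)) of
extensional functions {a..b} \<Rightarrow> real with the product sigma-algebra.\<close>

abbreviation path_space :: "real \<Rightarrow> real \<Rightarrow> (real \<Rightarrow> real) measure" where
  "path_space a b \<equiv> PiM {a..b} (\<lambda>_. borel)"

definition log_plus :: "real \<Rightarrow> real" where
  "log_plus x = (if x \<le> 1 then 0 else ln x)"

definition lin_interp :: "(real \<Rightarrow> real) \<Rightarrow> real \<Rightarrow> real \<Rightarrow> real \<Rightarrow> real" where
  "lin_interp f a b s = f a + (s - a) / (b - a) * (f b - f a)"

definition centered_normal :: "real \<Rightarrow> real measure" where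
  "centered_normal v = (if v = 0 then return borel 0
                        else density lborel (normal_density 0 (sqrt v)))"

definition bb_cov :: "real \<Rightarrow> real \<Rightarrow> real \<Rightarrow> real \<Rightarrow> real" where
  "bb_cov a b s t = (min s t - a) * (b - max s t) / (b - a)"

text \<open>Law of the standard Brownian bridge on {a..b}: the centered Gaussian process with
covariance bb_cov a b (Gaussian = every finite linear combination is centered normal with
the variance prescribed by the covariance).\<close>
definition brownian_bridge_law :: "real \<Rightarrow> real \<Rightarrow> (real \<Rightarrow> real) measure \<Rightarrow> bool" where
  "brownian_bridge_law a b M \<longleftrightarrow>
     prob_space M \<and> sets M = sets (path_space a b) \<and>
     (\<forall>J (c :: real \<Rightarrow> real). finite J \<longrightarrow> J \<subseteq> {a..b} \<longrightarrow>
        distr M borel (\<lambda>f. \<Sum>t\<in>J. c t * f t)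
          = centered_normal (\<Sum>s\<in>J. \<Sum>t\<in>J. c s * c t * bb_cov a b s t))"

end

theory Submission
  imports Defs
begin

text \<open>
  Let \<open>Y\<close> be the value at \<open>1/2\<close> of the process on \<open>[0,1]\<close>. Resampling on \<open>[1/4,3/4]\<close>, then on
  \<open>[0,1/2]\<close> and \<open>[1/2,1]\<close>, shows that \<open>Y\<close> has the law of
  \<open>Y\<^sub>1/2 + (Y\<^sub>2 + Y\<^sub>3)/(2\<surd>2) + Y\<^sub>4/\<surd>2\<close> with independent copies \<open>Y\<^sub>i\<close> of \<open>Y\<close>; the squares of the
  weights add up to \<open>1\<close>. If \<open>\<phi>\<close> is the characteristic function of \<open>Y\<close>, then
  \<open>-ln \<bar>\<phi>(u)\<bar>\<^sup>2/u\<^sup>2\<close> is therefore an average of its own values at smaller arguments, hence bounded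
  along a sequence tending to \<open>0\<close>, and Fatou's lemma gives \<open>Y\<close> a second moment. The mean vanishes
  because the weights do not add up to \<open>1\<close>, and iterating the equation forces \<open>\<phi>\<close> to be Gaussian.
  Midpoint displacement then determines the finite-dimensional laws at dyadic times, and stochastic
  continuity those at all times.

  When the variance is \<open>0\<close> the family itself does not supply a Brownian bridge, so one is constructed
  by Levy's series of Schauder functions with independent normal coefficients.
\<close>

section \<open>A distributional fixed-point equation\<close>

text \<open>No power moment of \<open>Y\<close> is given, so neither a mean nor a Taylor expansion
  of \<open>\<phi>\<close> is available at the start; the second moment has to come out of the
  equation. Logarithms achieve this: \<open>|\<phi>|^2\<close> is the characteristic function of the
  difference of two independent copies of \<open>Y\<close>, hence real, and positive near 0. Its
  logarithm turns the product into a sum in which, after division by \<open>u^2\<close>, the weights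
  enter through their squares. That these add up to 1 matters again for uniqueness: a bound
  \<open>e * u^2\<close> on the difference of two solutions reproduces itself exactly, with no gain,
  so smallness must be imported from 0, where finite variance provides it. Independence is handled
  by characteristic functions throughout. For an additive functional of the path the domain Markov
  property becomes a product formula, and each resampling is one application of it. Resampling both
  halves of the interval mirrors a recursion of the bridge covariance; the same recursion, read as a
  series, yields Levy's construction.\<close>

lemma (in real_distribution) integral_cos_diff:
  shows "integrable (M \<Otimes>\<^sub>M M) (\<lambda>p. cos (u * (fst p - snd p)))"
    and "(\<integral>p. cos (u * (fst p - snd p)) \<partial>(M \<Otimes>\<^sub>M M)) = (cmod (char M u))\<^sup>2"
proof -
  interpret PP: pair_prob_space M M ..
  let ?F = "\<lambda>p::real\<times>real. iexp (u * (fst p - snd p))"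
  have intF: "integrable (M \<Otimes>\<^sub>M M) ?F"
    by (rule PP.P.integrable_iexp) auto
  have ReF: "Re (?F p) = cos (u * (fst p - snd p))" for p
    by (simp add: Re_exp)
  show "integrable (M \<Otimes>\<^sub>M M) (\<lambda>p. cos (u * (fst p - snd p)))"
    using integrable_Re[OF intF] unfolding ReF .
  have "(\<integral>p. ?F p \<partial>(M \<Otimes>\<^sub>M M)) = (\<integral>x. (\<integral>y. iexp (u * (x - y)) \<partial>M) \<partial>M)"
    using PP.integral_fst'[OF intF] by simp
  also have "\<dots> = (\<integral>x. (\<integral>y. iexp (u * x) * cnj (iexp (u * y)) \<partial>M) \<partial>M)"
  proof -
    have "iexp (u * (x - y)) = iexp (u * x) * cnj (iexp (u * y))" for x y
      by (simp add: exp_cnj exp_add[symmetric] algebra_simps)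
    then show ?thesis by simp
  qed
  also have "\<dots> = char M u * cnj (char M u)"
    by (simp add: char_def)
  also have "\<dots> = complex_of_real ((cmod (char M u))\<^sup>2)"
    by (metis complex_norm_square of_real_power)
  finally have "Re (\<integral>p. ?F p \<partial>(M \<Otimes>\<^sub>M M)) = (cmod (char M u))\<^sup>2" by simp
  then show "(\<integral>p. cos (u * (fst p - snd p)) \<partial>(M \<Otimes>\<^sub>M M)) = (cmod (char M u))\<^sup>2"
    unfolding integral_Re[OF intF, symmetric] ReF .
qed

lemma tendsto_cos_quotient:
  fixes z :: real
  assumes h: "h \<longlonglongrightarrow> 0" and h0: "\<And>n. h n > (0::real)"
  shows "(\<lambda>n. (1 - cos (h n * z)) / (h n)\<^sup>2) \<longlonglongrightarrow> z\<^sup>2 / 2"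
proof -
  have sinc_lim: "((\<lambda>x::real. sin x / x) \<longlongrightarrow> 1) (at 0)"
    using DERIV_sin[of 0] unfolding DERIV_def by simp
  show ?thesis
  proof (cases "z = 0")
    case False
    have *: "(1 - cos (h n * z)) / (h n)\<^sup>2
        = z\<^sup>2 / 2 * (sin (h n * z / 2) / (h n * z / 2))\<^sup>2" for n
    proof -
      have "1 - cos (h n * z) = 2 * (sin (h n * z / 2))\<^sup>2"
        using cos_double_sin[of "h n * z / 2"] by simp
      then show ?thesis using h0[of n] False by (simp add: field_simps power2_eq_square)
    qed
    have "(\<lambda>n. sin (h n * z / 2) / (h n * z / 2)) \<longlonglongrightarrow> 1"
    proof (rule filterlim_compose[OF sinc_lim])
      have "(\<lambda>n. h n * z / 2) \<longlonglongrightarrow> 0 * z / 2"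
        by (intro tendsto_intros h) simp
      then show "filterlim (\<lambda>n. h n * z / 2) (at 0) sequentially"
        using h0 False less_imp_neq[OF h0] by (auto simp: filterlim_at)
    qed
    then have "(\<lambda>n. z\<^sup>2 / 2 * (sin (h n * z / 2) / (h n * z / 2))\<^sup>2) \<longlonglongrightarrow> z\<^sup>2 / 2 * 1\<^sup>2"
      by (intro tendsto_intros)
    then show ?thesis unfolding * by simp
  qed simp
qed

text \<open>The quantity \<open>1 - |char M h|^2\<close> is the mean of
  \<open>1 - cos (h (X - X'))\<close> for independent copies, so the bound controls second-order
  quotients of the symmetrised variable. These are nonnegative with pointwise limit
  \<open>(X - X')^2 / 2\<close>; Fatou works along any sequence, so a bound along some
  \<open>h\<close> tending to 0 is enough.\<close>

lemma (in real_distribution) square_integrable_of_char_bound: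
  assumes h: "h \<longlonglongrightarrow> 0" and h0: "\<And>n. h n > 0"
    and bd: "\<And>n. 1 - (cmod (char M (h n)))\<^sup>2 \<le> G * (h n)\<^sup>2"
  shows "integrable M (\<lambda>x. x\<^sup>2)"
proof -
  interpret PP: pair_prob_space M M ..
  let ?q = "\<lambda>n p. (1 - cos (h n * (fst p - snd p))) / (h n)\<^sup>2"
  have q0: "0 \<le> ?q n p" for n and p :: "real\<times>real" by simp
  have qint: "integrable (M \<Otimes>\<^sub>M M) (?q n)" for n
    using integral_cos_diff(1)[of "h n"] by auto
  have "(\<integral>p. ?q n p \<partial>(M \<Otimes>\<^sub>M M)) = (1 - (cmod (char M (h n)))\<^sup>2) / (h n)\<^sup>2" for n
    using integral_cos_diff[of "h n"] PP.P.prob_space by simp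
  then have qle: "(\<integral>p. ?q n p \<partial>(M \<Otimes>\<^sub>M M)) \<le> G" for n
    using bd[of n] h0[of n] by (metis pos_divide_le_eq zero_less_power)
  have "(\<integral>\<^sup>+p. ennreal ((fst p - snd p)\<^sup>2 / 2) \<partial>(M \<Otimes>\<^sub>M M))
      = (\<integral>\<^sup>+p. liminf (\<lambda>n. ennreal (?q n p)) \<partial>(M \<Otimes>\<^sub>M M))"
  proof (rule nn_integral_cong)
    fix p :: "real\<times>real"
    have "(\<lambda>n. ennreal (?q n p)) \<longlonglongrightarrow> ennreal ((fst p - snd p)\<^sup>2 / 2)"
      by (intro tendsto_ennrealI tendsto_cos_quotient h h0)
    then show "ennreal ((fst p - snd p)\<^sup>2 / 2) = liminf (\<lambda>n. ennreal (?q n p))"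
      using lim_imp_Liminf[OF sequentially_bot] by metis
  qed
  also have "\<dots> \<le> liminf (\<lambda>n. \<integral>\<^sup>+p. ennreal (?q n p) \<partial>(M \<Otimes>\<^sub>M M))"
    by (intro nn_integral_liminf) measurable
  also have "\<dots> \<le> ennreal G"
  proof (rule Liminf_le)
    show "\<forall>\<^sub>F n in sequentially. (\<integral>\<^sup>+p. ennreal (?q n p) \<partial>(M \<Otimes>\<^sub>M M)) \<le> ennreal G"
      using ennreal_leI[OF qle] nn_integral_eq_integral[OF qint always_eventually[OF allI[OF q0]]]
      by (intro always_eventually allI) (simp only:)
  qed simp
  finally have fin: "(\<integral>\<^sup>+p. ennreal ((fst p - snd p)\<^sup>2 / 2) \<partial>(M \<Otimes>\<^sub>M M)) < \<infinity>"
    by (simp only: infinity_ennreal_def order.strict_trans1[OF _ ennreal_less_top])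
  have "integrable (M \<Otimes>\<^sub>M M) (\<lambda>p. (fst p - snd p)\<^sup>2 / 2)"
    by (rule integrableI_bounded) (use fin in auto)
  \<comment> \<open>Symmetrisation is undone by Fubini: one copy is frozen at a value
    \<open>y\<close>, and \<open>x^2 <= 2 (y - x)^2 + 2 y^2\<close> removes the shift.\<close>
  then have "AE y in M. integrable M (\<lambda>x. (y - x)\<^sup>2 / 2)"
    using PP.AE_integrable_fst' by fastforce
  then obtain y where "integrable M (\<lambda>x. (y - x)\<^sup>2 / 2)"
    using eventually_happens[of _ "ae_filter M"] ae_filter_eq_bot_iff emeasure_space_1
    by (metis (no_types, lifting) zero_neq_one)
  then have "integrable M (\<lambda>x. 4 * ((y - x)\<^sup>2 / 2) + 2 * y\<^sup>2)"
    by (intro Bochner_Integration.integrable_add integrable_mult_right) auto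
  then show ?thesis
  proof (rule Bochner_Integration.integrable_bound)
    have "x\<^sup>2 \<le> 4 * ((y - x)\<^sup>2 / 2) + 2 * y\<^sup>2" for x
    proof -
      have "4 * ((y - x)\<^sup>2 / 2) + 2 * y\<^sup>2 - x\<^sup>2 = (x - 2 * y)\<^sup>2"
        by (simp add: power2_eq_square field_simps)
      then show ?thesis by (smt (verit) zero_le_power2)
    qed
    then show "AE x in M. norm (x\<^sup>2) \<le> norm (4 * ((y - x)\<^sup>2 / 2) + 2 * y\<^sup>2)"
      by (intro always_eventually allI) (simp add: order_trans[OF _ abs_ge_self])
  qed simp
qed

text \<open>Fourier form of the equation for \<open>Y\<close>: the arguments are \<open>u\<close>
  times the four weights, and \<open>u / (2 * sqrt 2)\<close> occurs twice, once for each half of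
  the interval.\<close>

definition smoothing :: "(real \<Rightarrow> 'a::comm_monoid_mult) \<Rightarrow> bool" where
  "smoothing \<phi> \<longleftrightarrow>
    (\<forall>u. \<phi> u = \<phi> (u / 2) * \<phi> (u / (2 * sqrt 2)) * \<phi> (u / (2 * sqrt 2)) * \<phi> (u / sqrt 2))"

lemma (in real_distribution) smoothing_square_integrable:
  assumes eq: "smoothing (char M)"
  shows "integrable M (\<lambda>x. x\<^sup>2)"
proof -
  define r where "r u = (cmod (char M u))\<^sup>2" for u
  have req: "r u = r (u / 2) * r (u / (2 * sqrt 2)) * r (u / (2 * sqrt 2)) * r (u / sqrt 2)" for u
    using eq[unfolded smoothing_def, rule_format, of u] unfolding r_def by (simp add: norm_mult power_mult_distrib)
  have "isCont r 0"
    unfolding r_def by (intro continuous_intros isCont_char)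
  moreover have "r 0 = 1" by (simp add: r_def char_zero)
  ultimately have "(r \<longlongrightarrow> 1) (at 0)" by (simp add: isCont_def)
  then have "\<forall>\<^sub>F u in at 0. 0 < r u" by (rule order_tendstoD(1)) simp
  then obtain d where d: "d > 0" "\<And>u. \<bar>u\<bar> < d \<Longrightarrow> r u > 0"
    unfolding eventually_at using \<open>r 0 = 1\<close>
    by (metis UNIV_I diff_zero dist_real_def zero_less_one)
  define g where "g u = - ln (r u) / u\<^sup>2" for u
  define G where "G = g (d/2)"
  \<comment> \<open>Dividing by \<open>u^2\<close> turns each weight into its square, hence the
    coefficients 1/4, 1/8, 1/8, 1/2, whose sum is 1.\<close>
  have geq: "g u = (1/4) * g (u / 2) + (1/8) * g (u / (2 * sqrt 2)) + (1/8) * g (u / (2 * sqrt 2))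
      + (1/2) * g (u / sqrt 2)" if u: "0 < u" "u < d" for u
  proof -
    have s: "1 \<le> sqrt 2" by simp
    have a: "\<bar>u/2\<bar> < d" "\<bar>u / (2 * sqrt 2)\<bar> < d" "\<bar>u / sqrt 2\<bar> < d"
    proof -
      show "\<bar>u/2\<bar> < d" using u by simp
      have s2: "1 \<le> 2 * sqrt 2" using s by linarith
      have "u / (2 * sqrt 2) \<le> u / 1" by (rule divide_left_mono[OF s2]) (use u in auto)
      then show "\<bar>u / (2 * sqrt 2)\<bar> < d" using u by simp
      have "u / sqrt 2 \<le> u / 1" by (rule divide_left_mono) (use u s in auto)
      then show "\<bar>u / sqrt 2\<bar> < d" using u by simp
    qed
    have "ln (r u) = ln (r (u / 2)) + ln (r (u / (2 * sqrt 2))) + ln (r (u / (2 * sqrt 2))) + ln (r (u / sqrt 2))"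
      using d(2)[OF a(1)] d(2)[OF a(2)] d(2)[OF a(3)] by (subst req) (simp add: ln_mult)
    then show ?thesis unfolding g_def using u
      by (simp add: power_divide power_mult_distrib field_simps)
  qed
  \<comment> \<open>The terms of an average cannot all exceed it, so one of the smaller arguments
    has a value of \<open>g\<close> that is no larger. Its factor is at most
    \<open>1 / sqrt 2\<close>, so the arguments found in this way decrease geometrically.\<close>
  have ex: "\<exists>h. 0 < h \<and> h \<le> d / 2 * (1 / sqrt 2) ^ n \<and> g h \<le> G" for n
  proof (induction n)
    case 0
    then show ?case using d(1) by (auto simp: G_def intro!: exI[of _ "d/2"])
  next
    case (Suc n)
    then obtain h where h: "0 < h" "h \<le> d / 2 * (1 / sqrt 2) ^ n" "g h \<le> G" by auto
    have "h < d" using h(2) power_le_one[of "1 / sqrt 2" n] d(1)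
      by (smt (verit) divide_le_eq_1_pos mult_left_le field_sum_of_halves real_sqrt_ge_1_iff zero_le_divide_1_iff)
    from geq[OF h(1) this] have "g (h / 2) \<le> g h \<or> g (h / (2 * sqrt 2)) \<le> g h \<or> g (h / sqrt 2) \<le> g h"
      by (rule_tac ccontr) (simp only: de_Morgan_disj not_le, linarith)
    then obtain a where a: "a \<in> {2, 2 * sqrt 2, sqrt 2}" "g (h / a) \<le> g h" by auto
    have "sqrt 2 \<le> a" using a(1) by (auto intro: real_le_lsqrt)
    then have "h / a \<le> h / sqrt 2" and "a > 0" using h(1)
      by (auto intro!: divide_left_mono mult_pos_pos less_le_trans[of 0 "sqrt 2" a])
    moreover have "h / sqrt 2 \<le> d / 2 * (1 / sqrt 2) ^ Suc n"
      using h(2) by (simp add: field_simps)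
    ultimately show ?case using a(2) h by (intro exI[of _ "h / a"]) auto
  qed
  then obtain h where h: "\<And>n. 0 < h n" "\<And>n. h n \<le> d / 2 * (1 / sqrt 2) ^ n" "\<And>n. g (h n) \<le> G"
    by metis
  have lim: "(\<lambda>n. d / 2 * (1 / sqrt 2) ^ n) \<longlonglongrightarrow> d / 2 * 0"
    by (intro tendsto_intros LIMSEQ_realpow_zero) auto
  have "h \<longlonglongrightarrow> 0"
    by (rule tendsto_sandwich[OF _ _ tendsto_const, of _ _ _ "\<lambda>n. d / 2 * (1 / sqrt 2) ^ n"])
      (use h(1,2) lim in \<open>auto intro!: always_eventually less_imp_le\<close>)
  moreover have "1 - r (h n) \<le> G * (h n)\<^sup>2" for n
  proof -
    have "(1 / sqrt 2) ^ n \<le> (1::real)" by (rule power_le_one) auto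
    then have "d / 2 * (1 / sqrt 2) ^ n \<le> d / 2 * 1"
      using d(1) by (intro mult_left_mono) auto
    then have "\<bar>h n\<bar> < d" using h(1,2)[of n] d(1) by linarith
    \<comment> \<open>\<open>ln x <= x - 1\<close> passes from the bound on \<open>- ln r\<close> to
      the bound on \<open>1 - r\<close> that the Fatou argument expects.\<close>
    then have "ln (r (h n)) \<le> r (h n) - 1" by (intro ln_le_minus_one d)
    moreover have "- ln (r (h n)) \<le> G * (h n)\<^sup>2"
      using h(3)[of n] h(1)[of n] by (simp add: g_def field_simps)
    ultimately show ?thesis by linarith
  qed
  ultimately show ?thesis
    using square_integrable_of_char_bound[of h G] h(1) by (auto simp: r_def)
qed

section \<open>Mean and second-order expansion at 0\<close>

lemma (in real_distribution) char_has_vector_derivative_0: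
  assumes i2: "integrable M (\<lambda>x. x\<^sup>2)"
  shows "(char M has_vector_derivative (\<i> * complex_of_real (\<integral>x. x \<partial>M))) (at 0)"
proof -
  have i1: "integrable M (\<lambda>x. x)"
    using square_integrable_imp_integrable[OF _ i2] by simp
  \<comment> \<open>The first summand is the remainder of the expansion to order two, the second its
    quadratic term, moved into the error; what is left is the affine part.\<close>
  define C where "C = expectation (\<lambda>x. \<bar>x\<bar>^2) + (\<integral>x. x\<^sup>2 \<partial>M) / 2"
  have bd: "cmod (char M t - char M 0 - t *\<^sub>R (\<i> * complex_of_real (\<integral>x. x \<partial>M))) \<le> C * t\<^sup>2" for t
  proof -
    have "integrable M (\<lambda>x. x^k)" if "k \<le> 2" for k
      using that i1 i2 by (auto simp: le_Suc_eq numeral_2_eq_2)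
    then have "cmod (char M t - (\<Sum>k\<le>2. (\<i> * t) ^ k * expectation (\<lambda>x. x ^ k) / fact k)) \<le> t\<^sup>2 * expectation (\<lambda>x. \<bar>x\<bar>^2)"
      using char_approx1[of 2 t] by simp
    moreover have "(\<Sum>k\<le>2. (\<i> * t) ^ k * expectation (\<lambda>x. x ^ k) / fact k)
       = char M 0 + t *\<^sub>R (\<i> * complex_of_real (\<integral>x. x \<partial>M)) - complex_of_real (t\<^sup>2 * (\<integral>x. x\<^sup>2 \<partial>M) / 2)"
      using prob_space by (simp add: numeral_2_eq_2 char_zero scaleR_conv_of_real algebra_simps)
    moreover have "c - (x + y - z) = c - x - y + z" for c x y z :: complex
      by simp
    ultimately have "cmod (char M t - char M 0 - t *\<^sub>R (\<i> * complex_of_real (\<integral>x. x \<partial>M)) + complex_of_real (t\<^sup>2 * (\<integral>x. x\<^sup>2 \<partial>M) / 2))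
        \<le> t\<^sup>2 * expectation (\<lambda>x. \<bar>x\<bar>^2)" by (simp only:)
    moreover have "cmod (complex_of_real (t\<^sup>2 * (\<integral>x. x\<^sup>2 \<partial>M) / 2)) = t\<^sup>2 * (\<integral>x. x\<^sup>2 \<partial>M) / 2"
      unfolding norm_of_real by (rule abs_of_nonneg) simp
    ultimately have "cmod (char M t - char M 0 - t *\<^sub>R (\<i> * complex_of_real (\<integral>x. x \<partial>M))) \<le> t\<^sup>2 * expectation (\<lambda>x. \<bar>x\<bar>^2) + t\<^sup>2 * (\<integral>x. x\<^sup>2 \<partial>M) / 2"
      by (smt (verit) norm_diff_ineq)
    then show ?thesis by (simp add: C_def algebra_simps)
  qed
  have "((\<lambda>t. (char M t - char M 0 - t *\<^sub>R (\<i> * complex_of_real (\<integral>x. x \<partial>M))) /\<^sub>R \<bar>t\<bar>) \<longlongrightarrow> 0) (at 0)"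
  proof (rule Lim_null_comparison)
    show "\<forall>\<^sub>F t in at 0. cmod ((char M t - char M 0 - t *\<^sub>R (\<i> * complex_of_real (\<integral>x. x \<partial>M))) /\<^sub>R \<bar>t\<bar>) \<le> C * \<bar>t\<bar>"
      unfolding eventually_at_filter
    proof (intro always_eventually allI impI)
      fix t :: real assume t: "t \<noteq> 0"
      have "cmod ((char M t - char M 0 - t *\<^sub>R (\<i> * complex_of_real (\<integral>x. x \<partial>M))) /\<^sub>R \<bar>t\<bar>)
        = cmod (char M t - char M 0 - t *\<^sub>R (\<i> * complex_of_real (\<integral>x. x \<partial>M))) / \<bar>t\<bar>"
        by (simp add: divide_inverse_commute)
      also have "\<dots> \<le> C * \<bar>t\<bar>\<^sup>2 / \<bar>t\<bar>" using bd[of t] by (intro divide_right_mono) auto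
      also have "\<dots> = C * \<bar>t\<bar>" using t by (cases "t > 0") (auto simp: power2_eq_square)
      finally show "cmod ((char M t - char M 0 - t *\<^sub>R (\<i> * complex_of_real (\<integral>x. x \<partial>M))) /\<^sub>R \<bar>t\<bar>) \<le> C * \<bar>t\<bar>" .
    qed
    have "((\<lambda>t::real. C * \<bar>t\<bar>) \<longlongrightarrow> C * \<bar>0\<bar>) (at 0)" by (intro tendsto_intros)
    then show "((\<lambda>t::real. C * \<bar>t\<bar>) \<longlongrightarrow> 0) (at 0)" by simp
  qed
  then show ?thesis
    unfolding has_vector_derivative_def has_derivative_at2
    by (simp add: bounded_linear_scaleR_left divide_inverse diff_diff_eq)
qed

text \<open>All factors equal 1 at 0, so differentiating there multiplies the derivative by the sum
  of the weights, \<open>1/2 + 2 / (2 * sqrt 2) + 1 / sqrt 2 = 1/2 + sqrt 2\<close>.\<close>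

lemma (in real_distribution) smoothing_mean_zero:
  assumes eq: "smoothing (char M)" and i2: "integrable M (\<lambda>x. x\<^sup>2)"
  shows "(\<integral>x. x \<partial>M) = 0"
proof -
  define m where "m = \<i> * complex_of_real (\<integral>x. x \<partial>M)"
  have D: "(char M has_vector_derivative m) (at 0)"
    using char_has_vector_derivative_0[OF i2] by (simp add: m_def)
  have Dc: "((\<lambda>u. char M (u / c)) has_vector_derivative m / of_real c) (at 0)" if "c \<noteq> 0" for c :: real
  proof -
    have "((\<lambda>u. u / c) has_vector_derivative 1 / c) (at 0)"
      using that
      by (auto intro!: derivative_eq_intros simp: has_real_derivative_iff_has_vector_derivative[symmetric])
    from vector_diff_chain_at[OF this, of "char M" m] D
    show ?thesis using that by (simp add: o_def scaleR_conv_of_real field_simps)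
  qed
  have "((\<lambda>u. char M (u / 2) * char M (u / (2 * sqrt 2)) * char M (u / (2 * sqrt 2)) * char M (u / sqrt 2))
     has_vector_derivative m / of_real 2 + m / of_real (2 * sqrt 2) + m / of_real (2 * sqrt 2) + m / of_real (sqrt 2)) (at 0)"
    by (rule has_vector_derivative_eq_rhs, rule has_vector_derivative_mult[OF has_vector_derivative_mult[OF has_vector_derivative_mult[OF Dc Dc] Dc] Dc])
      (simp_all add: char_zero algebra_simps)
  moreover have "(\<lambda>u. char M (u / 2) * char M (u / (2 * sqrt 2)) * char M (u / (2 * sqrt 2)) * char M (u / sqrt 2)) = char M"
    using eq unfolding smoothing_def by (intro ext) metis
  ultimately have "m = m / of_real 2 + m / of_real (2 * sqrt 2) + m / of_real (2 * sqrt 2) + m / of_real (sqrt 2)"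
    using vector_derivative_unique_at[OF D] by metis
  also have "\<dots> = m * of_real (1 / 2 + sqrt 2)"
    by (simp add: complex_eq_iff field_simps Re_divide_of_real Im_divide_of_real)
  finally have "m = m * of_real (1 / 2 + sqrt 2)" .
  moreover have "1 / 2 + sqrt 2 \<noteq> (1::real)" using real_sqrt_ge_1_iff[of 2] by linarith
  then have "complex_of_real (1 / 2 + sqrt 2) \<noteq> 1" by (simp only: of_real_eq_1_iff) simp
  ultimately have "m = 0" by (metis mult_cancel_left1)
  then show ?thesis by (simp add: m_def)
qed

text \<open>Two moments give an error \<open>o(t^2)\<close> without a rate. The minimum of
  \<open>6 x^2\<close> and \<open>|t| |x|^3\<close> tends to 0 pointwise and is dominated by
  \<open>6 x^2\<close>, so dominated convergence replaces a third moment.\<close>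

lemma (in real_distribution) char_second_order:
  assumes i2: "integrable M (\<lambda>x. x\<^sup>2)" and m: "(\<integral>x. x \<partial>M) = 0"
  shows "((\<lambda>t. (char M t - (1 - t\<^sup>2 * (\<integral>x. x\<^sup>2 \<partial>M) / 2)) / t\<^sup>2) \<longlongrightarrow> 0) (at 0)"
proof -
  have i1: "integrable M (\<lambda>x. x)"
    using square_integrable_imp_integrable[OF _ i2] by simp
  let ?w = "\<lambda>t x. min (6 * x\<^sup>2) (\<bar>t\<bar> * \<bar>x\<bar>^3)"
  have "variance (\<lambda>x. x) = (\<integral>x. x\<^sup>2 \<partial>M)" using m by simp
  from char_approx3[OF i1 m i2 this]
  have bd: "cmod (char M t - (1 - t\<^sup>2 * (\<integral>x. x\<^sup>2 \<partial>M) / 2)) \<le> t\<^sup>2 / 6 * expectation (?w t)" for t by simp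
  have "((\<lambda>t. expectation (?w t)) \<longlongrightarrow> 0) (at 0)"
    unfolding tendsto_at_iff_sequentially comp_def
  proof (intro allI impI)
    fix X :: "nat \<Rightarrow> real" assume X: "X \<longlonglongrightarrow> 0"
    have "(\<lambda>n. expectation (?w (X n))) \<longlonglongrightarrow> expectation (\<lambda>x. 0)"
    proof (rule integral_dominated_convergence[where w="\<lambda>x. 6 * x\<^sup>2"])
      show "AE x in M. (\<lambda>n. ?w (X n) x) \<longlonglongrightarrow> 0"
      proof (intro always_eventually allI)
        fix x :: real
        have "(\<lambda>n. ?w (X n) x) \<longlonglongrightarrow> min (6 * x\<^sup>2) (\<bar>0\<bar> * \<bar>x\<bar>^3)" by (intro tendsto_intros X)
        then show "(\<lambda>n. ?w (X n) x) \<longlonglongrightarrow> 0" by (simp add: min_absorb2)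
      qed
    qed (use i2 in auto)
    then show "(\<lambda>n. expectation (?w (X n))) \<longlonglongrightarrow> 0" by simp
  qed
  then have "((\<lambda>t. expectation (?w t) / 6) \<longlongrightarrow> 0) (at 0)" by (auto intro: tendsto_eq_intros)
  then show ?thesis
  proof (rule Lim_null_comparison[rotated])
    show "\<forall>\<^sub>F t in at 0. cmod ((char M t - (1 - t\<^sup>2 * (\<integral>x. x\<^sup>2 \<partial>M) / 2)) / t\<^sup>2) \<le> expectation (?w t) / 6"
      unfolding eventually_at_filter using bd
      by (intro always_eventually allI impI) (simp add: norm_divide norm_power field_simps)
  qed
qed


section \<open>Uniqueness for the equation\<close>

lemma norm_mult_diff_le:
  fixes a b c d :: complex
  assumes "cmod a \<le> 1" "cmod d \<le> 1"
  shows "cmod (a * b - c * d) \<le> cmod (a - c) + cmod (b - d)"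
proof -
  have "a * b - c * d = a * (b - d) + d * (a - c)" by (simp add: algebra_simps)
  then have "cmod (a * b - c * d) \<le> cmod a * cmod (b - d) + cmod d * cmod (a - c)"
    by (metis norm_mult norm_triangle_ineq)
  also have "\<dots> \<le> 1 * cmod (b - d) + 1 * cmod (a - c)"
    using assms by (intro add_mono mult_right_mono) auto
  finally show ?thesis by simp
qed

text \<open>For factors of modulus at most 1 the difference of products is at most the sum of the
  differences, so the distance \<open>D\<close> of two solutions is subadditive along the equation.
  Since the squared weights add up to 1, a bound \<open>e * u^2\<close> passes unchanged from the
  smaller arguments to \<open>u\<close>; near 0 it holds for every positive \<open>e\<close> by
  \<open>lim\<close>.\<close>

lemma smoothing_contraction:
  fixes \<phi> \<psi> :: "real \<Rightarrow> complex"
  assumes eq: "smoothing \<phi>" "smoothing \<psi>"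
    and le: "\<And>u. cmod (\<phi> u) \<le> 1" "\<And>u. cmod (\<psi> u) \<le> 1"
    and lim: "((\<lambda>u. (\<phi> u - \<psi> u) / (of_real u)\<^sup>2) \<longlongrightarrow> 0) (at 0)"
    and zero: "\<phi> 0 = \<psi> 0"
  shows "\<phi> = \<psi>"
proof -
  define D where "D u = cmod (\<phi> u - \<psi> u)" for u
  have Dle: "D u \<le> D (u / 2) + D (u / (2 * sqrt 2)) + D (u / (2 * sqrt 2)) + D (u / sqrt 2)" for u
  proof -
    let ?a = "u/2" and ?b = "u / (2 * sqrt 2)" and ?c = "u / sqrt 2"
    have m: "cmod (x * y) \<le> 1" if "cmod x \<le> 1" "cmod y \<le> 1" for x y
      using that by (simp add: norm_mult mult_le_one)
    have "D u = cmod (\<phi> ?a * \<phi> ?b * \<phi> ?b * \<phi> ?c - \<psi> ?a * \<psi> ?b * \<psi> ?b * \<psi> ?c)"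
      using eq[unfolded smoothing_def, rule_format, of u] by (simp add: D_def)
    also have "\<dots> \<le> cmod (\<phi> ?a * \<phi> ?b * \<phi> ?b - \<psi> ?a * \<psi> ?b * \<psi> ?b) + D ?c"
      unfolding D_def by (intro norm_mult_diff_le m le)
    also have "cmod (\<phi> ?a * \<phi> ?b * \<phi> ?b - \<psi> ?a * \<psi> ?b * \<psi> ?b) \<le> cmod (\<phi> ?a * \<phi> ?b - \<psi> ?a * \<psi> ?b) + D ?b"
      unfolding D_def by (intro norm_mult_diff_le m le)
    also have "cmod (\<phi> ?a * \<phi> ?b - \<psi> ?a * \<psi> ?b) \<le> D ?a + D ?b"
      unfolding D_def by (intro norm_mult_diff_le m le)
    finally show ?thesis by simp
  qed
  have small: "D u \<le> e * u\<^sup>2" if e: "e > 0" for e u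
  proof -
    from tendstoD[OF lim e] obtain d where d: "d > 0"
      "\<And>u. u \<noteq> 0 \<Longrightarrow> \<bar>u\<bar> < d \<Longrightarrow> cmod ((\<phi> u - \<psi> u) / (of_real u)\<^sup>2) < e"
      unfolding eventually_at by (auto simp: dist_real_def)
    have base: "D u \<le> e * u\<^sup>2" if u: "\<bar>u\<bar> < d" for u
    proof (cases "u = 0")
      case False
      from d(2)[OF this u] show ?thesis using False
        by (simp add: D_def norm_divide norm_power field_simps)
    qed (simp add: D_def zero)
    \<comment> \<open>Each application enlarges the range of validity by the factor
      \<open>sqrt 2\<close>, because the largest weight is \<open>1 / sqrt 2\<close>; the constant
      \<open>e\<close> stays the same.\<close>
    have iter: "\<bar>u\<bar> < d * sqrt 2 ^ n \<longrightarrow> D u \<le> e * u\<^sup>2" for u n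
    proof (induction n arbitrary: u)
      case 0
      then show ?case using base by simp
    next
      case (Suc n)
      show ?case
      proof
        assume "\<bar>u\<bar> < d * sqrt 2 ^ Suc n"
        then have c: "\<bar>u / sqrt 2\<bar> < d * sqrt 2 ^ n" by (simp add: field_simps)
        have s: "\<bar>u / x\<bar> < d * sqrt 2 ^ n" if x: "sqrt 2 \<le> x" for x
        proof -
          have "0 < sqrt 2 * x" using x by (intro mult_pos_pos less_le_trans[of 0 "sqrt 2" x]) auto
          then have "\<bar>u\<bar> / x \<le> \<bar>u\<bar> / sqrt 2"
            using x by (intro divide_left_mono) (auto simp: mult.commute)
          moreover have "\<bar>x\<bar> = x"
            using x order_trans[of 0 "sqrt 2" x] by simp
          ultimately show ?thesis using c by (simp add: abs_divide)
        qed
        have "sqrt 2 \<le> 2" by (rule real_le_lsqrt) auto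
        then have "D (u / 2) \<le> e * (u / 2)\<^sup>2" "D (u / (2 * sqrt 2)) \<le> e * (u / (2 * sqrt 2))\<^sup>2"
            "D (u / sqrt 2) \<le> e * (u / sqrt 2)\<^sup>2"
          using Suc.IH[of "u/2"] Suc.IH[of "u / (2 * sqrt 2)"] Suc.IH[of "u / sqrt 2"] s[of 2] s[of "2 * sqrt 2"] c
          by (simp_all del: abs_divide)
        then have "D u \<le> e * (u / 2)\<^sup>2 + e * (u / (2 * sqrt 2))\<^sup>2 + e * (u / (2 * sqrt 2))\<^sup>2 + e * (u / sqrt 2)\<^sup>2"
          using Dle[of u] by linarith
        also have "\<dots> = e * u\<^sup>2" by (simp add: power_divide power_mult_distrib)
        finally show "D u \<le> e * u\<^sup>2" .
      qed
    qed
    obtain n where "\<bar>u\<bar> / d < sqrt 2 ^ n"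
      using real_arch_pow[of "sqrt 2" "\<bar>u\<bar> / d"] by auto
    then show ?thesis using iter[of u n] d(1) by (simp add: field_simps)
  qed
  have "D u \<le> 0" for u
  proof (rule field_le_epsilon)
    fix e :: real assume "e > 0"
    show "D u \<le> 0 + e"
    proof (cases "u = 0")
      case False
      then show ?thesis using small[of "e / u\<^sup>2" u] \<open>e > 0\<close> by simp
    qed (use \<open>e > 0\<close> zero in \<open>simp add: D_def\<close>)
  qed
  then show ?thesis by (auto simp: D_def)
qed

lemma smoothing_gauss: "smoothing (\<lambda>u. complex_of_real (exp (- v * u\<^sup>2 / 2)))"
  unfolding smoothing_def
proof
  fix u :: real
  have "exp (- v * u\<^sup>2 / 2) = exp (- v * (u / 2)\<^sup>2 / 2) * exp (- v * (u / (2 * sqrt 2))\<^sup>2 / 2) *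
      exp (- v * (u / (2 * sqrt 2))\<^sup>2 / 2) * exp (- v * (u / sqrt 2)\<^sup>2 / 2)"
    by (simp add: exp_add[symmetric] power_divide power_mult_distrib)
  then show "complex_of_real (exp (- v * u\<^sup>2 / 2)) =
      complex_of_real (exp (- v * (u / 2)\<^sup>2 / 2)) * complex_of_real (exp (- v * (u / (2 * sqrt 2))\<^sup>2 / 2)) *
      complex_of_real (exp (- v * (u / (2 * sqrt 2))\<^sup>2 / 2)) * complex_of_real (exp (- v * (u / sqrt 2)\<^sup>2 / 2))"
    by (metis of_real_mult)
qed

lemma exp_second_order: "((\<lambda>u::real. (exp (- v * u\<^sup>2 / 2) - (1 - u\<^sup>2 * v / 2)) / u\<^sup>2) \<longlongrightarrow> 0) (at 0)"
proof -
  have "((\<lambda>h::real. (exp h - 1) / h) \<longlongrightarrow> 1) (at 0)"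
    using DERIV_exp[of 0] unfolding DERIV_def by simp
  \<comment> \<open>Filling in the value 1 at 0 allows composition with \<open>- v * u^2 / 2\<close>
    even when \<open>v = 0\<close>, where that expression is constantly 0.\<close>
  then have c: "isCont (\<lambda>h::real. if h = 0 then 1 else (exp h - 1) / h) 0"
    unfolding isCont_def by (simp, rule Lim_transform_eventually) (auto simp: eventually_at_filter)
  have "((\<lambda>u::real. - v * u\<^sup>2 / 2) \<longlongrightarrow> - v * 0\<^sup>2 / 2) (at 0)" by (intro tendsto_intros) simp
  then have "((\<lambda>u::real. - v * u\<^sup>2 / 2) \<longlongrightarrow> 0) (at 0)" by simp
  from isCont_tendsto_compose[OF c this]
  have "((\<lambda>u. (if - v * u\<^sup>2 / 2 = 0 then 1 else (exp (- v * u\<^sup>2 / 2) - 1) / (- v * u\<^sup>2 / 2)) - 1) \<longlongrightarrow> 1 - 1) (at 0)"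
    by (intro tendsto_diff tendsto_const) simp
  then have "((\<lambda>u. (- v / 2) * ((if - v * u\<^sup>2 / 2 = 0 then 1 else (exp (- v * u\<^sup>2 / 2) - 1) / (- v * u\<^sup>2 / 2)) - 1))
      \<longlongrightarrow> (- v / 2) * (1 - 1)) (at 0)"
    by (rule tendsto_mult_left)
  then have "((\<lambda>u. (- v / 2) * ((if - v * u\<^sup>2 / 2 = 0 then 1 else (exp (- v * u\<^sup>2 / 2) - 1) / (- v * u\<^sup>2 / 2)) - 1))
      \<longlongrightarrow> 0) (at 0)" by simp
  then show ?thesis
    by (rule Lim_transform_eventually) (auto simp: eventually_at_filter field_simps)
qed

proposition (in real_distribution) smoothing_char_eq_gauss:
  assumes eq: "smoothing (char M)"
  shows "\<exists>v\<ge>0. \<forall>u. char M u = complex_of_real (exp (- v * u\<^sup>2 / 2))"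
proof -
  have i2: "integrable M (\<lambda>x. x\<^sup>2)" by (rule smoothing_square_integrable[OF eq])
  have m: "(\<integral>x. x \<partial>M) = 0" by (rule smoothing_mean_zero[OF eq i2])
  define v where "v = (\<integral>x. x\<^sup>2 \<partial>M)"
  have v: "v \<ge> 0" by (simp add: v_def)
  let ?g = "\<lambda>u. complex_of_real (exp (- v * u\<^sup>2 / 2))"
  have "((\<lambda>u. complex_of_real ((exp (- v * u\<^sup>2 / 2) - (1 - u\<^sup>2 * v / 2)) / u\<^sup>2)) \<longlongrightarrow> complex_of_real 0) (at 0)"
    by (intro tendsto_of_real exp_second_order)
  with char_second_order[OF i2 m, folded v_def]
  have "((\<lambda>t. (char M t - complex_of_real (1 - t\<^sup>2 * v / 2)) / complex_of_real (t\<^sup>2)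
     - complex_of_real ((exp (- v * t\<^sup>2 / 2) - (1 - t\<^sup>2 * v / 2)) / t\<^sup>2)) \<longlongrightarrow> 0 - complex_of_real 0) (at 0)"
    by (rule tendsto_diff)
  then have "((\<lambda>u. (char M u - ?g u) / (of_real u)\<^sup>2) \<longlongrightarrow> 0) (at 0)"
    by (simp add: diff_divide_distrib[symmetric])
  then have "char M = ?g"
    by (intro smoothing_contraction eq smoothing_gauss cmod_char_le_1)
      (use v in \<open>auto simp: char_zero\<close>)
  then show ?thesis using v by metis
qed

section \<open>Gaussian laws and the covariance of the bridge\<close>

lemma real_distribution_centered_normal: "v \<ge> 0 \<Longrightarrow> real_distribution (centered_normal v)"
  unfolding centered_normal_def
  by (auto simp: real_distribution_def real_distribution_axioms_def prob_space_normal_density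
      intro!: prob_space_return)

lemma char_centered_normal:
  assumes "v \<ge> 0"
  shows "char (centered_normal v) u = complex_of_real (exp (- v * u\<^sup>2 / 2))"
proof (cases "v = 0")
  case True
  then show ?thesis by (simp add: centered_normal_def char_def integral_return)
next
  case False
  then have v: "v > 0" using assms by simp
  interpret S: real_distribution std_normal_distribution by (rule real_dist_normal_dist)
  have "distributed std_normal_distribution lborel (\<lambda>x. x) (normal_density 0 1)"
    unfolding distributed_def by (auto simp: distr_id2)
  from S.normal_density_affine[OF this, of "sqrt v" 0] v
  have "distr std_normal_distribution lborel (\<lambda>x. sqrt v * x) = density lborel (normal_density 0 (sqrt v))"
    by (simp add: distributed_def)
  then have "centered_normal v = distr std_normal_distribution lborel (\<lambda>x. sqrt v * x)"
    using v by (simp add: centered_normal_def)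
  then have "char (centered_normal v) u = (CLINT x|std_normal_distribution. iexp (u * (sqrt v * x)))"
    by (simp add: char_def integral_distr)
  also have "\<dots> = char std_normal_distribution (u * sqrt v)"
    by (simp add: char_def mult.assoc)
  also have "\<dots> = complex_of_real (exp (- v * u\<^sup>2 / 2))"
    using v by (simp add: char_std_normal_distribution power_mult_distrib mult.commute)
  finally show ?thesis .
qed

text \<open>The hypothesis speaks of the argument 1 only; other arguments are absorbed in the
  coefficients \<open>c\<close>, and Levy's uniqueness theorem then identifies the law of each
  linear combination.\<close>

lemma brownian_bridge_lawI:
  assumes M: "prob_space M" and sets: "sets M = sets (path_space a b)"
    and cf: "\<And>J c. finite J \<Longrightarrow> J \<subseteq> {a..b} \<Longrightarrow> (CLINT f|M. iexp (\<Sum>t\<in>J. c t * f t))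
        = complex_of_real (exp (- (\<Sum>s\<in>J. \<Sum>t\<in>J. c s * c t * bb_cov a b s t) / 2))"
  shows "brownian_bridge_law a b M"
  unfolding brownian_bridge_law_def
proof (intro conjI allI impI M sets)
  fix J :: "real set" and c :: "real \<Rightarrow> real"
  assume J: "finite J" "J \<subseteq> {a..b}"
  interpret prob_space M by fact
  let ?v = "\<Sum>s\<in>J. \<Sum>t\<in>J. c s * c t * bb_cov a b s t"
  let ?X = "\<lambda>f. \<Sum>t\<in>J. c t * f t"
  have [measurable]: "(\<lambda>f. f t) \<in> borel_measurable M" if "t \<in> J" for t
    using that J(2) unfolding measurable_cong_sets[OF sets refl]
    by (intro measurable_component_singleton) auto
  have X[measurable]: "?X \<in> borel_measurable M" by measurable
  interpret X: real_distribution "distr M borel ?X" by (rule real_distribution_distr[OF X])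
  have ch: "char (distr M borel ?X) u = complex_of_real (exp (- ?v * u\<^sup>2 / 2))" for u
  proof -
    have "char (distr M borel ?X) u = (CLINT f|M. iexp (\<Sum>t\<in>J. (u * c t) * f t))"
      by (simp add: char_def integral_distr sum_distrib_left mult.assoc)
    also have "\<dots> = complex_of_real (exp (- (\<Sum>s\<in>J. \<Sum>t\<in>J. (u * c s) * (u * c t) * bb_cov a b s t) / 2))"
      by (rule cf[OF J])
    also have "(\<Sum>s\<in>J. \<Sum>t\<in>J. (u * c s) * (u * c t) * bb_cov a b s t) = ?v * u\<^sup>2"
      by (simp add: sum_distrib_right sum_distrib_left power2_eq_square algebra_simps)
    finally show ?thesis by simp
  qed
  \<comment> \<open>Nonnegativity of the covariance form is read off from the hypothesis: a
    characteristic function has modulus at most 1, so the exponent cannot be positive.\<close>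
  have "?v \<ge> 0"
    using X.cmod_char_le_1[of 1] unfolding ch norm_of_real by simp
  then show "distr M borel ?X = centered_normal ?v"
    using ch by (intro Levy_uniqueness real_distribution_centered_normal X.real_distribution_axioms)
      (auto simp: char_centered_normal)
qed

section \<open>Self-similarity of the bridge covariance\<close>

definition tent :: "real \<Rightarrow> real" where
  "tent x = 2 * min x (1 - x)"

lemma bb_cov_01: "bb_cov 0 1 s t = min s t * (1 - max s t)"
  by (simp add: bb_cov_def)

lemma bb_cov_rescale: "(b - a) * bb_cov 0 1 ((s - a) / (b - a)) ((t - a) / (b - a)) = bb_cov a b s t" if "a \<le> b"
\<comment> \<open>For \<open>a = b\<close> both sides are 0, on the right because division by 0
  yields 0.\<close>
proof (cases "a = b")
  case False
  then have ab: "b - a > 0" using that by simp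
  have 1: "min ((s - a) / (b - a)) ((t - a) / (b - a)) = (min s t - a) / (b - a)"
    "max ((s - a) / (b - a)) ((t - a) / (b - a)) = (max s t - a) / (b - a)"
    using ab by (auto simp: min_def max_def divide_le_cancel)
  have 2: "1 - (max s t - a) / (b - a) = (b - max s t) / (b - a)" using ab by (simp add: field_simps)
  show ?thesis unfolding bb_cov_01 1 2 bb_cov_def using ab by simp
qed (simp add: bb_cov_def)

lemma bb_cov_rescale_sqrt:
  assumes "a \<le> b"
  shows "(x * sqrt (b - a)) * (y * sqrt (b - a)) * bb_cov 0 1 ((s - a) / (b - a)) ((t - a) / (b - a))
    = x * y * bb_cov a b s t"
proof -
  have "(x * sqrt (b - a)) * (y * sqrt (b - a)) = x * y * (b - a)"
    using assms by (simp add: algebra_simps flip: real_sqrt_mult)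
  then show ?thesis
    unfolding bb_cov_rescale[OF assms, symmetric, of s t] using assms by (simp add: mult.assoc)
qed

text \<open>The covariance form of midpoint displacement: a bridge is a random multiple of the tent
  function plus two independent half-size bridges.\<close>

lemma bb_cov_midpoint:
  assumes "s \<in> {0..1}" "t \<in> {0..1}"
  shows "bb_cov 0 1 s t = tent s * tent t / 4
    + (if s \<le> 1/2 \<and> t \<le> 1/2 then bb_cov 0 1 (2 * s) (2 * t) / 2 else 0)
    + (if 1/2 < s \<and> 1/2 < t then bb_cov 0 1 (2 * s - 1) (2 * t - 1) / 2 else 0)"
  using assms unfolding bb_cov_01 tent_def min_def max_def by (auto simp: field_simps)

section \<open>Existence of the Brownian bridge\<close>

text \<open>With this block-diagonal extension to the whole line the two half-size bridges of
  midpoint displacement are addressed by plain doubling of the arguments.\<close>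

definition bb_cov_per :: "real \<Rightarrow> real \<Rightarrow> real" where
  "bb_cov_per s t = (if \<lfloor>s\<rfloor> = \<lfloor>t\<rfloor> then bb_cov 0 1 (frac s) (frac t) else 0)"

lemma floor_double: "\<lfloor>2 * x\<rfloor> = 2 * \<lfloor>x\<rfloor> + (if frac x < 1/2 then 0 else 1)" for x :: real
  by (rule floor_unique) (auto simp: frac_def, linarith+)

text \<open>Doubling splits every unit block at its midpoint into two. The midpoint itself goes to
  the right block here but to the left one in \<open>bb_cov_midpoint\<close>; both are correct
  because the half-size bridges vanish at their ends.\<close>

lemma bb_cov_per_double:
  "bb_cov_per s t = (if \<lfloor>s\<rfloor> = \<lfloor>t\<rfloor> then tent (frac s) * tent (frac t) / 4 else 0)
    + bb_cov_per (2 * s) (2 * t) / 2"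
proof (cases "\<lfloor>s\<rfloor> = \<lfloor>t\<rfloor>")
  case True
  have fd: "frac (2 * x) = 2 * frac x - (if frac x < 1/2 then 0 else 1)" for x :: real
    using floor_double[of x] by (auto simp: frac_def)
  show ?thesis
    using True frac_ge_0[of s] frac_ge_0[of t] frac_lt_1[of s] frac_lt_1[of t]
      bb_cov_midpoint[of "frac s" "frac t"]
    unfolding bb_cov_per_def fd floor_double by (auto simp: bb_cov_01 tent_def min_def max_def field_simps)
next
  case False
  then have "\<lfloor>2 * s\<rfloor> \<noteq> \<lfloor>2 * t\<rfloor>" unfolding floor_double by auto
  then show ?thesis using False by (simp add: bb_cov_per_def)
qed

text \<open>Of the Schauder functions of level \<open>n\<close> only the one supported on the dyadic
  interval containing \<open>t\<close> matters, and this is its value at \<open>t\<close>. The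
  height \<open>1 / (2 * sqrt 2 ^ n)\<close> is the standard deviation, at the midpoint, of a bridge
  on an interval of length \<open>1 / 2 ^ n\<close>.\<close>

definition schauder :: "nat \<Rightarrow> real \<Rightarrow> real" where
  "schauder n t = tent (frac (2 ^ n * t)) / (2 * sqrt 2 ^ n)"

text \<open>Iterated doubling. Equality of the floors means that \<open>s\<close> and
  \<open>t\<close> lie in the same dyadic interval of level \<open>n\<close>, so that Levy's series
  attaches the same normal coefficient to both.\<close>

lemma bb_cov_per_expand:
  "bb_cov_per s t = (\<Sum>n<N. if \<lfloor>2 ^ n * s\<rfloor> = \<lfloor>2 ^ n * t\<rfloor> then schauder n s * schauder n t else 0)
     + bb_cov_per (2 ^ N * s) (2 ^ N * t) / 2 ^ N"
proof (induction N)
  case (Suc N)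
  have "sqrt 2 ^ N * sqrt 2 ^ N = (2::real) ^ N"
    by (simp flip: power_mult_distrib)
  then show ?case
    unfolding Suc by (subst bb_cov_per_double) (simp add: schauder_def field_simps mult.assoc)
qed simp

lemma bb_cov_per_sums:
  "(\<lambda>N. \<Sum>n<N. if \<lfloor>2 ^ n * s\<rfloor> = \<lfloor>2 ^ n * t\<rfloor> then schauder n s * schauder n t else 0) \<longlonglongrightarrow> bb_cov_per s t"
proof -
  have bd: "\<bar>bb_cov_per x y\<bar> \<le> 1" for x y
  proof -
    have "0 \<le> min (frac x) (frac y)" "min (frac x) (frac y) \<le> 1" "0 \<le> 1 - max (frac x) (frac y)" "1 - max (frac x) (frac y) \<le> 1"
      using frac_ge_0[of x] frac_ge_0[of y] frac_lt_1[of x] frac_lt_1[of y] by (auto simp: min_def max_def)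
    then show ?thesis unfolding bb_cov_per_def bb_cov_01 by (auto simp: abs_mult intro!: mult_le_one)
  qed
  have "(\<lambda>N. bb_cov_per (2 ^ N * s) (2 ^ N * t) / 2 ^ N) \<longlonglongrightarrow> 0"
  proof (rule Lim_null_comparison)
    show "\<forall>\<^sub>F N in sequentially. norm (bb_cov_per (2 ^ N * s) (2 ^ N * t) / 2 ^ N) \<le> (1/2) ^ N"
      using bd by (intro always_eventually allI) (simp add: abs_divide power_one_over field_simps)
    show "(\<lambda>N. (1/2::real) ^ N) \<longlonglongrightarrow> 0" by (rule LIMSEQ_realpow_zero) auto
  qed
  then have "(\<lambda>N. bb_cov_per s t - bb_cov_per (2 ^ N * s) (2 ^ N * t) / 2 ^ N) \<longlonglongrightarrow> bb_cov_per s t - 0"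
    by (intro tendsto_diff tendsto_const)
  moreover have "bb_cov_per s t - bb_cov_per (2 ^ N * s) (2 ^ N * t) / 2 ^ N
     = (\<Sum>n<N. if \<lfloor>2 ^ n * s\<rfloor> = \<lfloor>2 ^ n * t\<rfloor> then schauder n s * schauder n t else 0)" for N
    using bb_cov_per_expand[of s t N] by linarith
  ultimately show ?thesis by simp
qed

text \<open>Only the endpoint 1 is delicate: its floor puts it into the next block, but the bridge
  vanishes there, so both sides are 0.\<close>

lemma bb_cov_per_eq_bb_cov:
  assumes "s \<in> {0..1}" "t \<in> {0..1}"
  shows "bb_cov_per s t = bb_cov 0 1 s t"
proof -
  have fl: "\<lfloor>x\<rfloor> = (if x = 1 then 1 else 0)" if "x \<in> {0..1}" for x :: real
    using that by (auto simp: floor_eq_iff)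
  show ?thesis using assms fl[of s] fl[of t]
    unfolding bb_cov_per_def bb_cov_01 by (auto simp: frac_def min_def max_def)
qed

section \<open>Levy's series with normal coefficients\<close>

abbreviation gauss_noise :: "(nat \<times> int \<Rightarrow> real) measure" where
  "gauss_noise \<equiv> PiM UNIV (\<lambda>_. std_normal_distribution)"

interpretation gauss_noise: product_prob_space "\<lambda>_. std_normal_distribution" "UNIV :: (nat \<times> int) set"
  using prob_space_normal_density[of 1 0]
  by (auto simp: product_prob_space_def product_sigma_finite_def product_prob_space_axioms_def
      intro: prob_space_imp_sigma_finite)

lemma char_gauss_noise:
  assumes F: "finite F"
  shows "(CLINT \<omega>|gauss_noise. iexp (\<Sum>i\<in>F. \<alpha> i * \<omega> i)) = complex_of_real (exp (- (\<Sum>i\<in>F. (\<alpha> i)\<^sup>2) / 2))"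
proof -
  have "(CLINT \<omega>|gauss_noise. iexp (\<Sum>i\<in>F. \<alpha> i * \<omega> i))
     = (CLINT \<omega>|distr gauss_noise (PiM F (\<lambda>_. std_normal_distribution)) (\<lambda>x. restrict x F). \<Prod>i\<in>F. iexp (\<alpha> i * \<omega> i))"
    by (subst integral_distr) (auto simp: sum_distrib_left exp_sum[OF F] cong: prod.cong)
  also have "\<dots> = (CLINT \<omega>|PiM F (\<lambda>_. std_normal_distribution). \<Prod>i\<in>F. iexp (\<alpha> i * \<omega> i))"
    by (subst gauss_noise.distr_PiM_restrict_finite[OF F]) auto
  also have "\<dots> = (\<Prod>i\<in>F. CLINT x|std_normal_distribution. iexp (\<alpha> i * x))"
    by (rule gauss_noise.product_integral_prod[OF F]) (auto intro!: prob_space.integrable_iexp prob_space_normal_density)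
  also have "\<dots> = (\<Prod>i\<in>F. complex_of_real (exp (- (\<alpha> i)\<^sup>2 / 2)))"
    using char_std_normal_distribution by (intro prod.cong refl) (simp add: char_def fun_eq_iff)
  also have "\<dots> = complex_of_real (exp (- (\<Sum>i\<in>F. (\<alpha> i)\<^sup>2) / 2))"
    by (simp add: exp_sum[OF F, symmetric] sum_negf sum_divide_distrib flip: of_real_prod)
  finally show ?thesis .
qed

text \<open>The index \<open>(n, \<lfloor>2 ^ n * t\<rfloor>)\<close> labels the one Schauder
  function of level \<open>n\<close> that is seen at \<open>t\<close>. Where the series diverges
  \<open>suminf\<close> returns some default; for each \<open>t\<close> this concerns a null set
  depending on \<open>t\<close>, which is harmless for laws at finitely many times.\<close>

definition levy_bridge :: "(nat \<times> int \<Rightarrow> real) \<Rightarrow> real \<Rightarrow> real" where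
  "levy_bridge \<omega> t = (\<Sum>n. schauder n t * \<omega> (n, \<lfloor>2 ^ n * t\<rfloor>))"

lemma measurable_gauss_noise_component [measurable]: "(\<lambda>\<omega>. \<omega> i) \<in> borel_measurable gauss_noise"
proof -
  have "(\<lambda>\<omega>. \<omega> i) \<in> measurable gauss_noise std_normal_distribution"
    by (rule measurable_component_singleton) simp
  then show ?thesis by simp
qed

lemma borel_measurable_levy_bridge [measurable]: "(\<lambda>\<omega>. levy_bridge \<omega> t) \<in> borel_measurable gauss_noise"
  unfolding levy_bridge_def by measurable

text \<open>The first absolute moments of the terms are bounded by a geometric sequence, so the sum
  of the absolute values has finite expectation and the series converges absolutely almost
  surely.\<close>

lemma levy_bridge_sums_AE:
  "AE \<omega> in gauss_noise. (\<lambda>N. \<Sum>n<N. schauder n t * \<omega> (n, \<lfloor>2 ^ n * t\<rfloor>)) \<longlonglongrightarrow> levy_bridge \<omega> t"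
proof -
  define C where "C = (\<integral>x. \<bar>x\<bar> \<partial>std_normal_distribution)"
  let ?X = "\<lambda>n \<omega>. \<bar>schauder n t * \<omega> (n, \<lfloor>2 ^ n * t\<rfloor>)\<bar>"
  have intx: "integrable std_normal_distribution (\<lambda>x. \<bar>x\<bar>)"
    using integrable_std_normal_distribution_moment[of 1] by auto
  have sch: "\<bar>schauder n t\<bar> \<le> (1 / sqrt 2) ^ n" for n
  proof -
    have "\<bar>tent (frac x)\<bar> \<le> 2" for x
      unfolding tent_def using frac_ge_0[of x] frac_lt_1[of x] by (auto simp: min_def)
    then show ?thesis by (simp add: schauder_def abs_divide power_one_over field_simps)
  qed
  have E: "(\<integral>\<^sup>+\<omega>. ennreal (?X n \<omega>) \<partial>gauss_noise) \<le> ennreal ((1 / sqrt 2) ^ n * C)" for n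
  proof -
    have "(\<integral>\<^sup>+\<omega>. ennreal (?X n \<omega>) \<partial>gauss_noise)
      = (\<integral>\<^sup>+x. ennreal \<bar>schauder n t * x\<bar> \<partial>distr gauss_noise std_normal_distribution (\<lambda>\<omega>. \<omega> (n, \<lfloor>2 ^ n * t\<rfloor>)))"
      by (subst nn_integral_distr) auto
    also have "distr gauss_noise std_normal_distribution (\<lambda>\<omega>. \<omega> (n, \<lfloor>2 ^ n * t\<rfloor>)) = std_normal_distribution"
      by (rule gauss_noise.PiM_component) simp
    also have "(\<integral>\<^sup>+x. ennreal \<bar>schauder n t * x\<bar> \<partial>std_normal_distribution)
        = ennreal (\<integral>x. \<bar>schauder n t\<bar> * \<bar>x\<bar> \<partial>std_normal_distribution)"
      unfolding abs_mult by (rule nn_integral_eq_integral) (use intx in auto)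
    also have "(\<integral>x. \<bar>schauder n t\<bar> * \<bar>x\<bar> \<partial>std_normal_distribution) = \<bar>schauder n t\<bar> * C"
      by (simp add: C_def)
    also have "ennreal \<dots> \<le> ennreal ((1 / sqrt 2) ^ n * C)"
      by (intro ennreal_leI mult_right_mono sch) (simp add: C_def)
    finally show ?thesis .
  qed
  have summ: "summable (\<lambda>n. (1 / sqrt 2) ^ n * C)"
    by (intro summable_mult2 summable_geometric) auto
  have C0: "C \<ge> 0" by (simp add: C_def)
  have "(\<integral>\<^sup>+\<omega>. (\<Sum>n. ennreal (?X n \<omega>)) \<partial>gauss_noise) = (\<Sum>n. \<integral>\<^sup>+\<omega>. ennreal (?X n \<omega>) \<partial>gauss_noise)"
    by (rule nn_integral_suminf) measurable
  also have "\<dots> \<le> (\<Sum>n. ennreal ((1 / sqrt 2) ^ n * C))"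
    by (intro suminf_le E) auto
  also have "\<dots> = ennreal (\<Sum>n. (1 / sqrt 2) ^ n * C)"
    by (rule suminf_ennreal2) (use C0 summ in auto)
  finally have "(\<integral>\<^sup>+\<omega>. (\<Sum>n. ennreal (?X n \<omega>)) \<partial>gauss_noise) \<noteq> \<infinity>"
    by (auto simp: top_unique)
  then have "AE \<omega> in gauss_noise. (\<Sum>n. ennreal (?X n \<omega>)) \<noteq> \<infinity>"
    by (rule nn_integral_PInf_AE[rotated]) measurable
  then show ?thesis
  proof eventually_elim
    case (elim \<omega>)
    then have "summable (\<lambda>n. ?X n \<omega>)"
      by (intro summable_suminf_not_top) auto
    then have "summable (\<lambda>n. schauder n t * \<omega> (n, \<lfloor>2 ^ n * t\<rfloor>))"
      by (rule summable_rabs_cancel)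
    then show ?case
      unfolding levy_bridge_def by (rule summable_LIMSEQ)
  qed
qed

lemma char_levy_bridge:
  assumes J: "finite J" and \<tau>: "\<And>i. i \<in> J \<Longrightarrow> \<tau> i \<in> {0..1}"
  shows "(CLINT \<omega>|gauss_noise. iexp (\<Sum>i\<in>J. c i * levy_bridge \<omega> (\<tau> i)))
    = complex_of_real (exp (- (\<Sum>i\<in>J. \<Sum>j\<in>J. c i * c j * bb_cov 0 1 (\<tau> i) (\<tau> j)) / 2))"
proof -
  define W where "W N \<omega> t = (\<Sum>n<N. schauder n t * \<omega> (n, \<lfloor>2 ^ n * t\<rfloor>))" for N :: nat and \<omega> :: "nat \<times> int \<Rightarrow> real" and t
  define q where "q N = (\<Sum>i\<in>J. \<Sum>j\<in>J. c i * c j *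
     (\<Sum>n<N. if \<lfloor>2 ^ n * \<tau> i\<rfloor> = \<lfloor>2 ^ n * \<tau> j\<rfloor> then schauder n (\<tau> i) * schauder n (\<tau> j) else 0))" for N :: nat
  have [measurable]: "(\<lambda>\<omega>. W N \<omega> t) \<in> borel_measurable gauss_noise" for N t
    unfolding W_def by measurable
  have cN: "(CLINT \<omega>|gauss_noise. iexp (\<Sum>i\<in>J. c i * W N \<omega> (\<tau> i))) = complex_of_real (exp (- q N / 2))" for N
  proof -
    \<comment> \<open>\<open>K\<close> collects the block indices met by the times up to level
      \<open>N\<close>, which makes the truncated sums depend on finitely many noise coordinates;
      \<open>\<alpha> p\<close> is the total coefficient of coordinate \<open>p\<close>.\<close>
    define K where "K = (\<lambda>(n, i). \<lfloor>2 ^ n * \<tau> i\<rfloor>) ` ({..<N} \<times> J)"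
    have K: "finite K" "\<And>n i. n < N \<Longrightarrow> i \<in> J \<Longrightarrow> \<lfloor>2 ^ n * \<tau> i\<rfloor> \<in> K"
      using J by (auto simp: K_def)
    define \<alpha> where "\<alpha> p = (\<Sum>i\<in>J. if snd p = \<lfloor>2 ^ fst p * \<tau> i\<rfloor> then c i * schauder (fst p) (\<tau> i) else 0)" for p
    have cart: "(\<Sum>p\<in>{..<N} \<times> K. h p) = (\<Sum>n<N. \<Sum>k\<in>K. h (n, k))" for h :: "nat \<times> int \<Rightarrow> real"
      by (simp add: sum.cartesian_product)
    have 1: "(\<Sum>i\<in>J. c i * W N \<omega> (\<tau> i)) = (\<Sum>p\<in>{..<N} \<times> K. \<alpha> p * \<omega> p)" for \<omega>
    proof -
      have "(\<Sum>p\<in>{..<N} \<times> K. \<alpha> p * \<omega> p)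
        = (\<Sum>n<N. \<Sum>k\<in>K. \<Sum>i\<in>J. if k = \<lfloor>2 ^ n * \<tau> i\<rfloor> then c i * schauder n (\<tau> i) * \<omega> (n, k) else 0)"
        unfolding cart \<alpha>_def sum_distrib_right
        by (auto intro!: sum.cong)
      also have "\<dots> = (\<Sum>n<N. \<Sum>i\<in>J. \<Sum>k\<in>K. if k = \<lfloor>2 ^ n * \<tau> i\<rfloor> then c i * schauder n (\<tau> i) * \<omega> (n, k) else 0)"
        by (intro sum.cong refl sum.swap)
      also have "\<dots> = (\<Sum>n<N. \<Sum>i\<in>J. c i * schauder n (\<tau> i) * \<omega> (n, \<lfloor>2 ^ n * \<tau> i\<rfloor>))"
        using K by (intro sum.cong refl) (subst sum.delta, auto)
      also have "\<dots> = (\<Sum>i\<in>J. \<Sum>n<N. c i * schauder n (\<tau> i) * \<omega> (n, \<lfloor>2 ^ n * \<tau> i\<rfloor>))"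
        by (rule sum.swap)
      also have "\<dots> = (\<Sum>i\<in>J. c i * W N \<omega> (\<tau> i))"
        by (simp add: W_def sum_distrib_left mult.assoc)
      finally show ?thesis by simp
    qed
    have 2: "(\<Sum>p\<in>{..<N} \<times> K. (\<alpha> p)\<^sup>2) = q N"
    proof -
      \<comment> \<open>In the expanded square a pair of times contributes to coordinate
        \<open>(n, k)\<close> only if both lie in block \<open>k\<close>. Summing over
        \<open>k\<close> leaves the condition that they share a block, the one in
        \<open>bb_cov_per_expand\<close>.\<close>
      have "(\<Sum>p\<in>{..<N} \<times> K. (\<alpha> p)\<^sup>2) = (\<Sum>n<N. \<Sum>k\<in>K. \<Sum>i\<in>J. \<Sum>j\<in>J.
          if k = \<lfloor>2 ^ n * \<tau> i\<rfloor> then (if \<lfloor>2 ^ n * \<tau> i\<rfloor> = \<lfloor>2 ^ n * \<tau> j\<rfloor> then c i * schauder n (\<tau> i) * (c j * schauder n (\<tau> j)) else 0) else 0)"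
        unfolding cart \<alpha>_def power2_eq_square sum_product
        by (auto intro!: sum.cong)
      also have "\<dots> = (\<Sum>n<N. \<Sum>i\<in>J. \<Sum>k\<in>K. \<Sum>j\<in>J.
          if k = \<lfloor>2 ^ n * \<tau> i\<rfloor> then (if \<lfloor>2 ^ n * \<tau> i\<rfloor> = \<lfloor>2 ^ n * \<tau> j\<rfloor> then c i * schauder n (\<tau> i) * (c j * schauder n (\<tau> j)) else 0) else 0)"
        by (intro sum.cong refl sum.swap)
      also have "\<dots> = (\<Sum>n<N. \<Sum>i\<in>J. \<Sum>j\<in>J. \<Sum>k\<in>K.
          if k = \<lfloor>2 ^ n * \<tau> i\<rfloor> then (if \<lfloor>2 ^ n * \<tau> i\<rfloor> = \<lfloor>2 ^ n * \<tau> j\<rfloor> then c i * schauder n (\<tau> i) * (c j * schauder n (\<tau> j)) else 0) else 0)"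
        by (intro sum.cong refl sum.swap)
      also have "\<dots> = (\<Sum>n<N. \<Sum>i\<in>J. \<Sum>j\<in>J.
          if \<lfloor>2 ^ n * \<tau> i\<rfloor> = \<lfloor>2 ^ n * \<tau> j\<rfloor> then c i * schauder n (\<tau> i) * (c j * schauder n (\<tau> j)) else 0)"
        using K by (intro sum.cong refl) (subst sum.delta, auto)
      also have "\<dots> = (\<Sum>i\<in>J. \<Sum>n<N. \<Sum>j\<in>J.
          if \<lfloor>2 ^ n * \<tau> i\<rfloor> = \<lfloor>2 ^ n * \<tau> j\<rfloor> then c i * schauder n (\<tau> i) * (c j * schauder n (\<tau> j)) else 0)"
        by (rule sum.swap)
      also have "\<dots> = (\<Sum>i\<in>J. \<Sum>j\<in>J. \<Sum>n<N.
          if \<lfloor>2 ^ n * \<tau> i\<rfloor> = \<lfloor>2 ^ n * \<tau> j\<rfloor> then c i * schauder n (\<tau> i) * (c j * schauder n (\<tau> j)) else 0)"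
        by (intro sum.cong refl sum.swap)
      also have "\<dots> = q N"
        unfolding q_def sum_distrib_left by (intro sum.cong refl) auto
      finally show ?thesis .
    qed
    show ?thesis unfolding 1
      by (subst char_gauss_noise) (use K in \<open>auto simp: 2\<close>)
  qed
  have "q \<longlonglongrightarrow> (\<Sum>i\<in>J. \<Sum>j\<in>J. c i * c j * bb_cov_per (\<tau> i) (\<tau> j))"
    unfolding q_def by (intro tendsto_sum tendsto_mult tendsto_const bb_cov_per_sums)
  also have "(\<Sum>i\<in>J. \<Sum>j\<in>J. c i * c j * bb_cov_per (\<tau> i) (\<tau> j))
      = (\<Sum>i\<in>J. \<Sum>j\<in>J. c i * c j * bb_cov 0 1 (\<tau> i) (\<tau> j))"
    using \<tau> by (intro sum.cong refl) (simp add: bb_cov_per_eq_bb_cov)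
  finally have "(\<lambda>N. complex_of_real (exp (- q N / 2))) \<longlonglongrightarrow>
      complex_of_real (exp (- (\<Sum>i\<in>J. \<Sum>j\<in>J. c i * c j * bb_cov 0 1 (\<tau> i) (\<tau> j)) / 2))"
    by (intro tendsto_intros) auto
  moreover have "(\<lambda>N. CLINT \<omega>|gauss_noise. iexp (\<Sum>i\<in>J. c i * W N \<omega> (\<tau> i)))
      \<longlonglongrightarrow> (CLINT \<omega>|gauss_noise. iexp (\<Sum>i\<in>J. c i * levy_bridge \<omega> (\<tau> i)))"
  proof (rule integral_dominated_convergence[where w="\<lambda>_. 1"])
    have "AE \<omega> in gauss_noise. \<forall>i\<in>J. (\<lambda>N. W N \<omega> (\<tau> i)) \<longlonglongrightarrow> levy_bridge \<omega> (\<tau> i)"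
      using J levy_bridge_sums_AE by (intro AE_finite_allI) (auto simp: W_def)
    then show "AE \<omega> in gauss_noise. (\<lambda>N. iexp (\<Sum>i\<in>J. c i * W N \<omega> (\<tau> i)))
        \<longlonglongrightarrow> iexp (\<Sum>i\<in>J. c i * levy_bridge \<omega> (\<tau> i))"
      by eventually_elim (intro tendsto_intros, auto)
  qed (auto simp: gauss_noise.P.emeasure_space_1)
  ultimately show ?thesis
    unfolding cN by (intro LIMSEQ_unique)
qed

proposition brownian_bridge_exists:
  assumes ab: "a \<le> b"
  shows "\<exists>B. brownian_bridge_law a b B"
proof
  let ?Y = "\<lambda>\<omega>. restrict (\<lambda>t. sqrt (b - a) * levy_bridge \<omega> ((t - a) / (b - a))) {a..b}"
  have Y[measurable]: "?Y \<in> measurable gauss_noise (path_space a b)"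
    by (rule measurable_restrict) measurable
  show "brownian_bridge_law a b (distr gauss_noise (path_space a b) ?Y)"
  proof (rule brownian_bridge_lawI)
    show "prob_space (distr gauss_noise (path_space a b) ?Y)"
      by (rule gauss_noise.P.prob_space_distr[OF Y])
    fix J :: "real set" and c :: "real \<Rightarrow> real"
    assume J: "finite J" "J \<subseteq> {a..b}"
    have *: "(t - a) / (b - a) \<in> {0..1}" if "t \<in> J" for t
      using that J(2) ab by (auto simp: divide_le_eq_1)
    have [measurable]: "(\<lambda>f. f t) \<in> borel_measurable (path_space a b)" if "t \<in> J" for t
      using that J(2) by (intro measurable_component_singleton) auto
    have "(CLINT f|distr gauss_noise (path_space a b) ?Y. iexp (\<Sum>t\<in>J. c t * f t))
      = (CLINT \<omega>|gauss_noise. iexp (\<Sum>t\<in>J. (c t * sqrt (b - a)) * levy_bridge \<omega> ((t - a) / (b - a))))"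
      using J(2) by (subst integral_distr) (auto simp: subset_iff mult.assoc intro!: Bochner_Integration.integral_cong sum.cong)
    also have "\<dots> = complex_of_real (exp (- (\<Sum>s\<in>J. \<Sum>t\<in>J. (c s * sqrt (b - a)) * (c t * sqrt (b - a)) *
         bb_cov 0 1 ((s - a) / (b - a)) ((t - a) / (b - a))) / 2))"
      by (rule char_levy_bridge[OF J(1) *])
    also have "(\<Sum>s\<in>J. \<Sum>t\<in>J. (c s * sqrt (b - a)) * (c t * sqrt (b - a)) *
         bb_cov 0 1 ((s - a) / (b - a)) ((t - a) / (b - a))) = (\<Sum>s\<in>J. \<Sum>t\<in>J. c s * c t * bb_cov a b s t)"
      by (simp only: bb_cov_rescale_sqrt[OF ab])
    finally show "(CLINT f|distr gauss_noise (path_space a b) ?Y. iexp (\<Sum>t\<in>J. c t * f t))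
        = complex_of_real (exp (- (\<Sum>s\<in>J. \<Sum>t\<in>J. c s * c t * bb_cov a b s t) / 2))" .
  qed simp
qed

section \<open>Families with the domain Markov property\<close>

text \<open>Both are laws of the null path: on a product set each takes the value 1 or 0 according
  to whether all constraints admit 0. This serves degenerate intervals and the case of variance
  0.\<close>

lemma path_measure_eqI_AE_zero:
  assumes M: "prob_space M" "sets M = sets (path_space a b)" "\<And>t. t \<in> {a..b} \<Longrightarrow> AE f in M. f t = 0"
    and N: "prob_space N" "sets N = sets (path_space a b)" "\<And>t. t \<in> {a..b} \<Longrightarrow> AE f in N. f t = 0"
  shows "M = N"
proof (rule measure_eqI_PiM_infinite)
  interpret M: prob_space M by fact
  show "finite_measure M" by (rule M.finite_measure_axioms)
  fix A :: "real \<Rightarrow> real set" and J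
  assume J: "finite J" "J \<subseteq> {a..b}" and A: "\<And>i. i \<in> J \<Longrightarrow> A i \<in> sets borel"
  let ?E = "prod_emb {a..b} (\<lambda>_. borel) J (Pi\<^sub>E J A)"
  have val: "emeasure Q ?E = (if \<forall>j\<in>J. 0 \<in> A j then 1 else 0)"
    if Q: "prob_space Q" "sets Q = sets (path_space a b)" "\<And>t. t \<in> {a..b} \<Longrightarrow> AE f in Q. f t = 0" for Q
  proof -
    interpret Q: prob_space Q by fact
    have E: "?E \<in> sets Q" unfolding Q(2) using J A by (intro sets_PiM_I) auto
    have sp: "space Q = space (path_space a b)" using Q(2) by (rule sets_eq_imp_space_eq)
    have "AE f in Q. \<forall>t\<in>J. f t = 0" using J Q(3) by (intro AE_finite_allI) auto
    then have *: "AE f in Q. (f \<in> ?E) = (\<forall>j\<in>J. 0 \<in> A j)"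
      using AE_space
    proof eventually_elim
      case (elim f)
      then show ?case using J(2) unfolding sp prod_emb_def
        by (auto simp: space_PiM PiE_iff)
    qed
    show ?thesis
    proof (cases "\<forall>j\<in>J. 0 \<in> A j")
      case True
      then have "AE f in Q. f \<in> ?E" by (intro eventually_mono[OF *]) simp
      then show ?thesis using Q.emeasure_eq_1_AE[OF E] True by simp
    next
      case False
      then have "AE f in Q. f \<notin> ?E" by (intro eventually_mono[OF *]) blast
      then have "emeasure Q ?E = 0" using AE_iff_null_sets[OF E] by auto
      then show ?thesis using False by simp
    qed
  qed
  have "emeasure M ?E = (if \<forall>j\<in>J. 0 \<in> A j then 1 else 0)" by (rule val) (fact M)+
  also have "\<dots> = emeasure N ?E" by (rule val[symmetric]) (fact N)+
  finally show "emeasure M ?E = emeasure N ?E" .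
qed (use M N in auto)

text \<open>Members of \<open>path_space 0 1\<close> have the value \<open>undefined\<close> outside
  the unit interval, whereas gluing produces functions on the whole line. The second clause makes
  \<open>L\<close> blind to this difference; additivity lets an exponential of \<open>L\<close>
  split into factors.\<close>

definition path_functional :: "((real \<Rightarrow> real) \<Rightarrow> real) \<Rightarrow> bool" where
  "path_functional L \<longleftrightarrow> (\<forall>f g. L (\<lambda>s. f s + g s) = L f + L g) \<and>
     (\<forall>f g. (\<forall>s\<in>{0..1}. f s = g s) \<longrightarrow> L f = L g) \<and>
     L \<in> borel_measurable (path_space 0 1)"

definition interp :: "real \<Rightarrow> real \<Rightarrow> (real \<Rightarrow> real) \<Rightarrow> real \<Rightarrow> real" where
  "interp a b f s = (if s \<in> {a..b} then lin_interp f a b s else f s)"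

text \<open>\<open>interp\<close> and \<open>shrink\<close> are the two summands of the domain
  Markov decomposition as operations on unit paths: the chord over \<open>{a..b}\<close> with the
  path kept outside, and a rescaled copy placed on \<open>{a..b}\<close> and extended by 0.\<close>

definition shrink :: "real \<Rightarrow> real \<Rightarrow> (real \<Rightarrow> real) \<Rightarrow> real \<Rightarrow> real" where
  "shrink a b f s = (if s \<in> {a..b} then sqrt (b - a) * f ((s - a) / (b - a)) else 0)"

lemma path_functional_comp:
  assumes L: "path_functional L"
    and add: "\<And>f g s. T (\<lambda>s. f s + g s) s = T f s + T g s"
    and loc: "\<And>f g s. \<forall>s\<in>{0..1}. f s = g s \<Longrightarrow> s \<in> {0..1} \<Longrightarrow> T f s = T g s"
    and meas: "\<And>s. s \<in> {0..1} \<Longrightarrow> (\<lambda>f. T f s) \<in> borel_measurable (path_space 0 1)"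
  shows "path_functional (\<lambda>f. L (T f))"
proof -
  have Lc: "L f = L g" if "\<forall>s\<in>{0..1}. f s = g s" for f g
    using L that unfolding path_functional_def by blast
  have Lm: "L \<in> borel_measurable (path_space 0 1)"
    using L unfolding path_functional_def by blast
  have "(\<lambda>f. L (T f)) = (\<lambda>f. L (restrict (T f) {0..1}))"
    by (intro ext Lc) simp
  moreover have "(\<lambda>f. restrict (T f) {0..1}) \<in> measurable (path_space 0 1) (path_space 0 1)"
    by (rule measurable_restrict) (rule meas)
  then have "(\<lambda>f. L (restrict (T f) {0..1})) \<in> borel_measurable (path_space 0 1)"
    by (rule measurable_compose[OF _ Lm])
  ultimately have m: "(\<lambda>f. L (T f)) \<in> borel_measurable (path_space 0 1)"
    by (simp only:)
  have "L (T (\<lambda>s. f s + g s)) = L (T f) + L (T g)" for f g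
  proof -
    have "T (\<lambda>s. f s + g s) = (\<lambda>s. T f s + T g s)" by (intro ext add)
    then show ?thesis using L unfolding path_functional_def by metis
  qed
  moreover have "L (T f) = L (T g)" if "\<forall>s\<in>{0..1}. f s = g s" for f g
    by (intro Lc ballI loc that)
  ultimately show ?thesis using m unfolding path_functional_def by blast
qed

lemma path_functional_interp:
  assumes L: "path_functional L" and ab: "0 \<le> a" "a < b" "b \<le> 1"
  shows "path_functional (\<lambda>f. L (interp a b f))"
proof (rule path_functional_comp[OF L])
  show "interp a b (\<lambda>s. f s + g s) s = interp a b f s + interp a b g s" for f g s
  proof -
    have "x + y + k * (z + w - (x + y)) = (x + k * (z - x)) + (y + k * (w - y))" for k x y z w :: real
      by (simp add: algebra_simps)
    then show ?thesis by (simp only: interp_def lin_interp_def) simp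
  qed
  show "(\<lambda>f. interp a b f s) \<in> borel_measurable (path_space 0 1)" if "s \<in> {0..1}" for s
  proof -
    have [measurable]: "(\<lambda>f. f a) \<in> borel_measurable (path_space 0 1)"
      "(\<lambda>f. f b) \<in> borel_measurable (path_space 0 1)" "(\<lambda>f. f s) \<in> borel_measurable (path_space 0 1)"
      using ab that by (auto intro!: measurable_component_singleton)
    show ?thesis unfolding interp_def lin_interp_def by measurable
  qed
qed (use ab in \<open>auto simp: interp_def lin_interp_def\<close>)

lemma rescale_in_unit: "a \<le> b \<Longrightarrow> s \<in> {a..b} \<Longrightarrow> (s - a) / (b - a) \<in> {0..1}" for s :: real
  by (auto simp: divide_le_eq_1)

lemma path_functional_shrink:
  assumes L: "path_functional L" and ab: "a < b"
  shows "path_functional (\<lambda>f. L (shrink a b f))"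
proof (rule path_functional_comp[OF L])
  show "(\<lambda>f. shrink a b f s) \<in> borel_measurable (path_space 0 1)" for s
    unfolding shrink_def using rescale_in_unit[of a b s] ab
    by (cases "s \<in> {a..b}") (auto intro!: borel_measurable_times measurable_component_singleton)
  show "shrink a b (\<lambda>s. f s + g s) s = shrink a b f s + shrink a b g s" for f g s
    by (simp add: shrink_def algebra_simps)
  show "shrink a b f s = shrink a b g s" if "\<forall>s\<in>{0..1}. f s = g s" for f g s
    using that rescale_in_unit[of a b s] ab by (auto simp: shrink_def)
qed

lemma path_functional_sum:
  assumes "\<And>i. i \<in> J \<Longrightarrow> \<tau> i \<in> {0..1}"
  shows "path_functional (\<lambda>f. \<Sum>i\<in>J. c i * f (\<tau> i))"
  unfolding path_functional_def
  using assms by (auto simp: algebra_simps sum.distrib intro!: sum.cong borel_measurable_sum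
      borel_measurable_times measurable_component_singleton)

lemma path_functional_coord: "t \<in> {0..1} \<Longrightarrow> path_functional (\<lambda>f. u * f t)"
  using path_functional_sum[of "{()}" "\<lambda>_. t" "\<lambda>_. u"] by simp

text \<open>Truncation at 2 keeps the bound integrable without any moment, so that convergence in
  probability of the coordinates is enough for convergence of characteristic functions.\<close>

lemma norm_iexp_diff_le: "cmod (iexp x - iexp y) \<le> min 2 \<bar>x - y\<bar>"
proof -
  have "iexp x - iexp y = iexp y * (iexp (x - y) - 1)"
    by (simp add: exp_diff right_diff_distrib of_real_diff)
  then have "cmod (iexp x - iexp y) = cmod (iexp (x - y) - 1)" by (simp add: norm_mult)
  also have "\<dots> \<le> \<bar>x - y\<bar>" using iexp_approx1[of "x - y" 0] by simp
  finally have 1: "cmod (iexp x - iexp y) \<le> \<bar>x - y\<bar>" .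
  have "cmod (iexp x - iexp y) \<le> cmod (iexp x) + cmod (iexp y)" by (rule norm_triangle_ineq4)
  then have "cmod (iexp x - iexp y) \<le> 2" by simp
  with 1 show ?thesis by simp
qed

lemma min_sum_le:
  fixes g :: "'i \<Rightarrow> real"
  assumes "finite J"
  shows "min 2 \<bar>\<Sum>i\<in>J. g i\<bar> \<le> (\<Sum>i\<in>J. min 2 \<bar>g i\<bar>)"
  using assms
proof (induction J)
  case (insert i J)
  have "min 2 \<bar>g i + sum g J\<bar> \<le> min 2 \<bar>g i\<bar> + min 2 \<bar>sum g J\<bar>" by (auto simp: min_def)
  then show ?case using insert by simp
qed simp

section \<open>Domain Markov families, reduced to the unit interval\<close>

locale bridge_family =
  fixes P :: "real \<Rightarrow> real \<Rightarrow> (real \<Rightarrow> real) measure"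
  assumes laws: "\<And>a b. a \<le> b \<Longrightarrow> prob_space (P a b) \<and> sets (P a b) = sets (path_space a b)"
    and stoch_cont: "\<And>a b t \<epsilon>. a \<le> b \<Longrightarrow> t \<in> {a..b} \<Longrightarrow> \<epsilon> > 0 \<Longrightarrow>
                  ((\<lambda>s. measure (P a b) {f \<in> space (P a b). \<epsilon> < \<bar>f t - f s\<bar>}) \<longlongrightarrow> 0)
                    (at t within {a..b})"
    and boundary: "\<And>a b. a \<le> b \<Longrightarrow> AE f in P a b. f a = 0 \<and> f b = 0"
    and markov: "\<And>a b c d. c \<le> a \<Longrightarrow> a \<le> b \<Longrightarrow> b \<le> d \<Longrightarrow>
                  P c d = distr (P c d \<Otimes>\<^sub>M P a b) (path_space c d)
                    (\<lambda>(f, g). restrict (\<lambda>s. if s \<in> {a..b} then lin_interp f a b s + g s else f s) {c..d})"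
    and transl: "\<And>a b x. a \<le> b \<Longrightarrow>
                  distr (P (a - x) (b - x)) (path_space a b) (\<lambda>f. restrict (\<lambda>t. f (t - x)) {a..b}) = P a b"
    and scaling: "\<And>a b c. a \<le> b \<Longrightarrow> c > 0 \<Longrightarrow>
                  distr (P (c * a) (c * b)) (path_space a b)
                    (\<lambda>f. restrict (\<lambda>t. f (c * t) / sqrt c) {a..b}) = P a b"
begin

lemma sets_P [measurable_cong]: "a \<le> b \<Longrightarrow> sets (P a b) = sets (path_space a b)"
  using laws by simp

lemma measurable_P: "a \<le> b \<Longrightarrow> measurable (P a b) N = measurable (path_space a b) N"
  by (rule measurable_cong_sets[OF sets_P refl])

lemma measurable_coord: "a \<le> b \<Longrightarrow> t \<in> {a..b} \<Longrightarrow> (\<lambda>f. f t) \<in> borel_measurable (P a b)"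
  unfolding measurable_P by (rule measurable_component_singleton)

sublocale unit: prob_space "P 0 1"
  using laws[of 0 1] by simp

abbreviation rescale :: "real \<Rightarrow> real \<Rightarrow> (real \<Rightarrow> real) \<Rightarrow> real \<Rightarrow> real" where
  "rescale a b f \<equiv> restrict (\<lambda>t. sqrt (b - a) * f ((t - a) / (b - a))) {a..b}"

lemma measurable_rescale: "a \<le> b \<Longrightarrow> rescale a b \<in> measurable (P 0 1) (path_space a b)"
  by (intro measurable_restrict borel_measurable_times measurable_const measurable_coord rescale_in_unit) auto

text \<open>Scaling followed by translation carries the unit interval to \<open>{a..b}\<close>, so
  the single law \<open>P 0 1\<close> determines the family. A point cannot be reached by a positive
  scale factor; there both sides are the law of the null path.\<close>

lemma P_eq_rescale:
  assumes ab: "a \<le> b"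
  shows "P a b = distr (P 0 1) (path_space a b) (rescale a b)"
proof (cases "a = b")
  case True
  show ?thesis
  proof (rule path_measure_eqI_AE_zero)
    show "AE f in P a b. f t = 0" if "t \<in> {a..b}" for t
      using boundary[OF ab] that True by (auto elim: eventually_mono)
    show "AE f in distr (P 0 1) (path_space a b) (rescale a b). f t = 0" if t: "t \<in> {a..b}" for t
      using t True by (subst AE_distr_iff[OF measurable_rescale[OF ab]]) (auto intro!: measurable_component_singleton)
    show "prob_space (distr (P 0 1) (path_space a b) (rescale a b))"
      by (rule unit.prob_space_distr[OF measurable_rescale[OF ab]])
  qed (use laws[OF ab] in auto)
next
  case False
  then have d: "b - a > 0" using ab by simp
  let ?S = "\<lambda>f. restrict (\<lambda>t. f (1 / (b - a) * t) / sqrt (1 / (b - a))) {0..b - a} :: real \<Rightarrow> real"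
  let ?T = "\<lambda>f. restrict (\<lambda>t. f (t - a)) {a..b} :: real \<Rightarrow> real"
  have S: "distr (P 0 1) (path_space 0 (b - a)) ?S = P 0 (b - a)"
    using scaling[of 0 "b - a" "1 / (b - a)"] d by simp
  have T: "distr (P 0 (b - a)) (path_space a b) ?T = P a b"
    using transl[OF ab, of a] by simp
  have mS: "?S \<in> measurable (P 0 1) (path_space 0 (b - a))"
    using d by (intro measurable_restrict borel_measurable_divide measurable_const measurable_coord) auto
  have mT: "?T \<in> measurable (path_space 0 (b - a)) (path_space a b)"
    by (intro measurable_restrict measurable_component_singleton) auto
  have "P a b = distr (P 0 1) (path_space a b) (?T \<circ> ?S)"
    unfolding T[symmetric] S[symmetric] by (rule distr_distr[OF mT mS])
  moreover have "?T \<circ> ?S = rescale a b"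
    using d by (auto simp: fun_eq_iff real_sqrt_divide restrict_def)
  ultimately show ?thesis by simp
qed

definition cf :: "((real \<Rightarrow> real) \<Rightarrow> real) \<Rightarrow> complex" where
  "cf L = (CLINT f|P 0 1. iexp (L f))"

lemma cf_cong_AE:
  assumes "path_functional L" "path_functional L'" "AE f in P 0 1. L f = L' f"
  shows "cf L = cf L'"
proof -
  have [measurable]: "L \<in> borel_measurable (P 0 1)" "L' \<in> borel_measurable (P 0 1)"
    using assms(1,2) by (auto simp: path_functional_def measurable_P)
  show ?thesis unfolding cf_def
    by (intro integral_cong_AE) (use assms(3) in \<open>auto elim: eventually_mono\<close>)
qed

text \<open>Additivity of \<open>L\<close> separates the chord part, a function of the first
  component, from the fresh part, a function of the independent second one, and Fubini gives a
  product. Rescaling turns the fresh factor into an expectation under \<open>P 0 1\<close> again, so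
  the formula can be iterated.\<close>

lemma cf_markov:
  assumes L: "path_functional L" and ab: "0 \<le> a" "a < b" "b \<le> 1"
  shows "cf L = cf (\<lambda>f. L (interp a b f)) * cf (\<lambda>f. L (shrink a b f))"
proof -
  interpret I: prob_space "P a b" using laws[of a b] ab by simp
  interpret PP: pair_prob_space "P 0 1" "P a b" ..
  let ?G = "\<lambda>(f, g). restrict (\<lambda>s. if s \<in> {a..b} then lin_interp f a b s + g s else f s) {0..1} :: real \<Rightarrow> real"
  \<comment> \<open>Paths under \<open>P a b\<close> carry no meaningful values outside
    \<open>{a..b}\<close>; they are extended by 0 before \<open>L\<close> is applied.\<close>
  define cut where "cut g = (\<lambda>s. if s \<in> {a..b} then g s else 0 :: real)" for g
  have add: "L (\<lambda>s. f s + g s) = L f + L g" and loc: "(\<And>s. s \<in> {0..1} \<Longrightarrow> f s = g s) \<Longrightarrow> L f = L g"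
    and meas[measurable]: "L \<in> borel_measurable (path_space 0 1)" for f g
    using L unfolding path_functional_def by auto
  have split: "L (?G (f, g)) = L (interp a b f) + L (cut g)" for f g
    unfolding add[symmetric] by (rule loc) (simp add: interp_def cut_def)
  have m1: "(\<lambda>p. fst p t) \<in> borel_measurable (P 0 1 \<Otimes>\<^sub>M P a b)" if "t \<in> {0..1}" for t
    by (rule measurable_compose[OF measurable_fst measurable_coord]) (use that in auto)
  have m2: "(\<lambda>p. snd p t) \<in> borel_measurable (P 0 1 \<Otimes>\<^sub>M P a b)" if "t \<in> {a..b}" for t
    by (rule measurable_compose[OF measurable_snd measurable_coord]) (use that ab in auto)
  have G: "?G \<in> measurable (P 0 1 \<Otimes>\<^sub>M P a b) (path_space 0 1)"
    unfolding case_prod_beta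
  proof (rule measurable_restrict)
    fix s :: real assume s: "s \<in> {0..1}"
    have [measurable]: "(\<lambda>p. fst p a) \<in> borel_measurable (P 0 1 \<Otimes>\<^sub>M P a b)"
      "(\<lambda>p. fst p b) \<in> borel_measurable (P 0 1 \<Otimes>\<^sub>M P a b)" using ab by (auto intro!: m1)
    show "(\<lambda>p. if s \<in> {a..b} then lin_interp (fst p) a b s + snd p s else fst p s)
      \<in> borel_measurable (P 0 1 \<Otimes>\<^sub>M P a b)"
      using m1[OF s] m2[of s] by (cases "s \<in> {a..b}") (auto simp: lin_interp_def)
  qed
  have mi: "(\<lambda>f. L (interp a b f)) \<in> borel_measurable (P 0 1)"
    using path_functional_interp[OF L ab] by (simp add: path_functional_def measurable_P)
  have "(\<lambda>g. L (restrict (cut g) {0..1})) \<in> borel_measurable (P a b)"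
  proof (rule measurable_compose[OF measurable_restrict meas])
    show "(\<lambda>g. cut g s) \<in> borel_measurable (P a b)" for s
      using measurable_coord[of a b s] ab by (cases "s \<in> {a..b}") (auto simp: cut_def)
  qed
  moreover have "L (restrict (cut g) {0..1}) = L (cut g)" for g by (rule loc) simp
  ultimately have mc: "(\<lambda>g. L (cut g)) \<in> borel_measurable (P a b)" by simp
  note [measurable] = mi mc
  have int: "integrable (P 0 1 \<Otimes>\<^sub>M P a b) (\<lambda>p. iexp (L (interp a b (fst p)) + L (cut (snd p))))"
    by (rule PP.P.integrable_iexp) measurable
  have "P 0 1 = distr (P 0 1 \<Otimes>\<^sub>M P a b) (path_space 0 1) ?G"
    by (rule markov) (use ab in auto)
  from arg_cong[OF this, of "\<lambda>M. CLINT f|M. iexp (L f)"]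
  have "cf L = (CLINT f|distr (P 0 1 \<Otimes>\<^sub>M P a b) (path_space 0 1) ?G. iexp (L f))"
    by (simp only: cf_def)
  also have "\<dots> = (CLINT p|P 0 1 \<Otimes>\<^sub>M P a b. iexp (L (?G p)))"
    by (rule integral_distr[OF G]) measurable
  also have "\<dots> = (CLINT p|P 0 1 \<Otimes>\<^sub>M P a b. iexp (L (interp a b (fst p)) + L (cut (snd p))))"
  proof (rule Bochner_Integration.integral_cong[OF refl])
    show "iexp (L (?G p)) = iexp (L (interp a b (fst p)) + L (cut (snd p)))" for p
      using split[of "fst p" "snd p"] by (simp only: prod.collapse)
  qed
  also have "\<dots> = (CLINT f|P 0 1. CLINT g|P a b. iexp (L (interp a b f) + L (cut g)))"
    using PP.integral_fst'[OF int] by simp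
  also have "\<dots> = (CLINT f|P 0 1. CLINT g|P a b. iexp (L (interp a b f)) * iexp (L (cut g)))"
    by (simp add: exp_add distrib_left)
  also have "\<dots> = cf (\<lambda>f. L (interp a b f)) * (CLINT g|P a b. iexp (L (cut g)))"
    by (simp add: cf_def)
  also have "(CLINT g|P a b. iexp (L (cut g))) = (CLINT f|P 0 1. iexp (L (cut (rescale a b f))))"
  proof -
    have "(\<lambda>g. L (cut g)) \<in> borel_measurable (path_space a b)"
      using mc measurable_P[of a b] ab by simp
    then have "(\<lambda>g. iexp (L (cut g))) \<in> borel_measurable (path_space a b)" by measurable
    then show ?thesis
      unfolding P_eq_rescale[OF less_imp_le[OF ab(2)]]
      by (rule integral_distr[OF measurable_rescale[OF less_imp_le[OF ab(2)]]])
  qed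
  also have "\<dots> = cf (\<lambda>f. L (shrink a b f))"
  proof -
    have "cut (rescale a b f) = shrink a b f" for f by (auto simp: cut_def shrink_def fun_eq_iff)
    then show ?thesis by (simp add: cf_def)
  qed
  finally show ?thesis .
qed

text \<open>The intervals are chosen so that every point of evaluation is the midpoint of the
  interval resampled. The chord over \<open>{1/4..3/4}\<close> replaces \<open>f (1/2)\<close> by
  the mean of \<open>f (1/4)\<close> and \<open>f (3/4)\<close>; the chords over the two halves
  replace this by \<open>f (1/2) / 2\<close>, as the endpoints carry 0. All three intervals have
  length 1/2, so a fresh part contributes \<open>f (1/2) / sqrt 2\<close> times the coefficient 1 or
  1/2 in front.\<close>

lemma smoothing_cf: "smoothing (\<lambda>u. cf (\<lambda>f. u * f (1/2)))"
  unfolding smoothing_def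
proof
  fix u :: real
  let ?\<phi> = "\<lambda>u. cf (\<lambda>f. u * f (1/2))"
  let ?L = "\<lambda>f::real\<Rightarrow>real. u * (f (1/4) + f (3/4)) / 2"
  have pf: "path_functional (\<lambda>f. x * f s + y * f t)" if "s \<in> {0..1}" "t \<in> {0..1}" for x y s t
    using path_functional_sum[of "{True, False}" "\<lambda>i. if i then s else t" "\<lambda>i. if i then x else y"] that
    by simp
  have half: "sqrt (1/2) = 1 / sqrt 2" by (simp add: real_sqrt_divide)
  have pf1: "path_functional ?L"
    using pf[of "1/4" "3/4" "u/2" "u/2"] by (simp add: algebra_simps add_divide_distrib)
  let ?L2 = "\<lambda>f. ?L (interp 0 (1/2) f)"
  have pf2: "path_functional ?L2" by (rule path_functional_interp[OF pf1]) auto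
  have "?\<phi> u = cf (\<lambda>f. u * interp (1/4) (3/4) f (1/2)) * cf (\<lambda>f. u * shrink (1/4) (3/4) f (1/2))"
    by (rule cf_markov[OF path_functional_coord]) auto
  also have "(\<lambda>f. u * interp (1/4) (3/4) f (1/2)) = ?L"
    by (auto simp: interp_def lin_interp_def fun_eq_iff field_simps)
  also have "(\<lambda>f. u * shrink (1/4) (3/4) f (1/2)) = (\<lambda>f. (u / sqrt 2) * f (1/2))"
    by (auto simp: shrink_def fun_eq_iff half)
  also have "cf ?L = cf ?L2 * cf (\<lambda>f. ?L (shrink 0 (1/2) f))"
    by (rule cf_markov[OF pf1]) auto
  also have "(\<lambda>f. ?L (shrink 0 (1/2) f)) = (\<lambda>f. u / (2 * sqrt 2) * f (1/2))"
    by (auto simp: shrink_def fun_eq_iff half)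
  also have "cf ?L2 = cf (\<lambda>f. ?L2 (interp (1/2) 1 f)) * cf (\<lambda>f. ?L2 (shrink (1/2) 1 f))"
    by (rule cf_markov[OF pf2]) auto
  also have "cf (\<lambda>f. ?L2 (interp (1/2) 1 f)) = ?\<phi> (u / 2)"
  proof (rule cf_cong_AE)
    show "path_functional (\<lambda>f. ?L2 (interp (1/2) 1 f))"
      by (rule path_functional_interp[OF pf2]) auto
    show "path_functional (\<lambda>f. (u / 2) * f (1/2))" by (rule path_functional_coord) auto
    have "AE f in P 0 1. f 0 = 0 \<and> f 1 = 0" by (rule boundary) simp
    then show "AE f in P 0 1. ?L2 (interp (1/2) 1 f) = u / 2 * f (1/2)"
      by eventually_elim (simp add: interp_def lin_interp_def field_simps)
  qed
  \<comment> \<open>\<open>?L2\<close> still contains the chord over the left half, but that is 0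
    here: the shrunken path is 0 at 0 and almost surely 0 at 1/2, so only the value at 3/4
    remains.\<close>
  also have "cf (\<lambda>f. ?L2 (shrink (1/2) 1 f)) = ?\<phi> (u / (2 * sqrt 2))"
  proof (rule cf_cong_AE)
    show "path_functional (\<lambda>f. ?L2 (shrink (1/2) 1 f))"
      by (rule path_functional_shrink[OF pf2]) auto
    show "path_functional (\<lambda>f. (u / (2 * sqrt 2)) * f (1/2))" by (rule path_functional_coord) auto
    have "AE f in P 0 1. f 0 = 0 \<and> f 1 = 0" by (rule boundary) simp
    then show "AE f in P 0 1. ?L2 (shrink (1/2) 1 f) = u / (2 * sqrt 2) * f (1/2)"
      by eventually_elim (simp add: interp_def lin_interp_def shrink_def half field_simps)
  qed
  finally show "?\<phi> u = ?\<phi> (u / 2) * ?\<phi> (u / (2 * sqrt 2)) * ?\<phi> (u / (2 * sqrt 2)) * ?\<phi> (u / sqrt 2)"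
    by (simp add: mult_ac)
qed

section \<open>Gaussian laws, from the midpoint to dyadic times\<close>

lemma cf_eq_char:
  assumes L: "path_functional L"
  shows "cf (\<lambda>f. u * L f) = char (distr (P 0 1) borel L) u"
proof -
  have "L \<in> borel_measurable (P 0 1)" using L by (simp add: path_functional_def measurable_P)
  then show ?thesis by (simp add: cf_def char_def integral_distr)
qed

text \<open>Since \<open>bb_cov 0 1 (1/2) (1/2) = 1/4\<close>, the factor 8 makes \<open>w\<close>
  the square of the final \<open>\<sigma>\<close>.\<close>

lemma cf_midpoint_gauss: "\<exists>w\<ge>0. \<forall>u. cf (\<lambda>f. u * f (1/2)) = complex_of_real (exp (- w * u\<^sup>2 / 8))"
proof -
  interpret Y: real_distribution "distr (P 0 1) borel (\<lambda>f. f (1/2))"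
    by (rule unit.real_distribution_distr) (auto intro!: measurable_coord)
  have eq: "cf (\<lambda>f. u * f (1/2)) = char (distr (P 0 1) borel (\<lambda>f. f (1/2))) u" for u
    using cf_eq_char[OF path_functional_coord[of "1/2" 1], of u] by simp
  have "smoothing (char (distr (P 0 1) borel (\<lambda>f. f (1/2))))"
    using smoothing_cf unfolding eq .
  from Y.smoothing_char_eq_gauss[OF this] obtain v where "v \<ge> 0"
    "\<And>u. char (distr (P 0 1) borel (\<lambda>f. f (1/2))) u = complex_of_real (exp (- v * u\<^sup>2 / 2))" by auto
  then show ?thesis unfolding eq by (intro exI[of _ "4 * v"]) simp
qed

text \<open>The probabilistic counterpart of \<open>bb_cov_midpoint\<close>: both halves are
  resampled given the value at 1/2. An index whose time lies in the other half is not dropped but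
  gets coefficient 0 and time 0, which keeps \<open>J\<close> fixed; time 1/2 counts as left, where
  it becomes the endpoint 1 and contributes 0 almost surely.\<close>

lemma cf_split_half:
  assumes J: "finite J" and \<tau>: "\<And>i. i \<in> J \<Longrightarrow> \<tau> i \<in> {0..1}"
  shows "cf (\<lambda>f. \<Sum>i\<in>J. c i * f (\<tau> i)) =
     cf (\<lambda>f. (\<Sum>i\<in>J. c i * tent (\<tau> i)) * f (1/2))
   * cf (\<lambda>f. \<Sum>i\<in>J. (if \<tau> i \<le> 1/2 then c i / sqrt 2 else 0) * f (if \<tau> i \<le> 1/2 then 2 * \<tau> i else 0))
   * cf (\<lambda>f. \<Sum>i\<in>J. (if 1/2 < \<tau> i then c i / sqrt 2 else 0) * f (if 1/2 < \<tau> i then 2 * \<tau> i - 1 else 0))"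
proof -
  have half: "sqrt (1/2) = 1 / sqrt 2" by (simp add: real_sqrt_divide)
  let ?L = "\<lambda>f::real\<Rightarrow>real. \<Sum>i\<in>J. c i * f (\<tau> i)"
  have pf1: "path_functional ?L" by (rule path_functional_sum[OF \<tau>])
  let ?L2 = "\<lambda>f. ?L (interp (1/2) 1 f)"
  have pf2: "path_functional ?L2" by (rule path_functional_interp[OF pf1]) auto
  have bd: "AE f in P 0 1. f 0 = 0 \<and> f 1 = 0" by (rule boundary) simp
  have "cf ?L = cf ?L2 * cf (\<lambda>f. ?L (shrink (1/2) 1 f))"
    by (rule cf_markov[OF pf1]) auto
  also have "cf ?L2 = cf (\<lambda>f. ?L2 (interp 0 (1/2) f)) * cf (\<lambda>f. ?L2 (shrink 0 (1/2) f))"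
    by (rule cf_markov[OF pf2]) auto
  also have "cf (\<lambda>f. ?L2 (interp 0 (1/2) f)) = cf (\<lambda>f. (\<Sum>i\<in>J. c i * tent (\<tau> i)) * f (1/2))"
  proof (rule cf_cong_AE)
    show "path_functional (\<lambda>f. ?L2 (interp 0 (1/2) f))"
      by (rule path_functional_interp[OF pf2]) auto
    show "path_functional (\<lambda>f. (\<Sum>i\<in>J. c i * tent (\<tau> i)) * f (1/2))" by (rule path_functional_coord) auto
    show "AE f in P 0 1. ?L2 (interp 0 (1/2) f) = (\<Sum>i\<in>J. c i * tent (\<tau> i)) * f (1/2)"
      using bd
    proof eventually_elim
      case (elim f)
      have "c i * interp (1/2) 1 (interp 0 (1/2) f) (\<tau> i) = c i * tent (\<tau> i) * f (1/2)" if "i \<in> J" for i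
        using elim \<tau>[OF that] by (auto simp: interp_def lin_interp_def tent_def min_def field_simps)
      then show ?case unfolding sum_distrib_right by (intro sum.cong refl)
    qed
  qed
  also have "cf (\<lambda>f. ?L2 (shrink 0 (1/2) f)) = cf (\<lambda>f. \<Sum>i\<in>J. (if \<tau> i \<le> 1/2 then c i / sqrt 2 else 0) * f (if \<tau> i \<le> 1/2 then 2 * \<tau> i else 0))"
  proof (rule cf_cong_AE)
    show "path_functional (\<lambda>f. ?L2 (shrink 0 (1/2) f))"
      by (rule path_functional_shrink[OF pf2]) auto
    show "path_functional (\<lambda>f. \<Sum>i\<in>J. (if \<tau> i \<le> 1/2 then c i / sqrt 2 else 0) * f (if \<tau> i \<le> 1/2 then 2 * \<tau> i else 0))"
      by (rule path_functional_sum) (use \<tau> in auto)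
    show "AE f in P 0 1. ?L2 (shrink 0 (1/2) f) = (\<Sum>i\<in>J. (if \<tau> i \<le> 1/2 then c i / sqrt 2 else 0) * f (if \<tau> i \<le> 1/2 then 2 * \<tau> i else 0))"
      using bd
    proof eventually_elim
      case (elim f)
      show ?case
      proof (rule sum.cong[OF refl])
        fix i assume "i \<in> J"
        then show "c i * interp (1/2) 1 (shrink 0 (1/2) f) (\<tau> i) =
          (if \<tau> i \<le> 1/2 then c i / sqrt 2 else 0) * f (if \<tau> i \<le> 1/2 then 2 * \<tau> i else 0)"
          using elim \<tau>[of i] by (cases "\<tau> i = 1/2") (auto simp: interp_def lin_interp_def shrink_def half mult.commute)
      qed
    qed
  qed
  also have "cf (\<lambda>f. ?L (shrink (1/2) 1 f)) = cf (\<lambda>f. \<Sum>i\<in>J. (if 1/2 < \<tau> i then c i / sqrt 2 else 0) * f (if 1/2 < \<tau> i then 2 * \<tau> i - 1 else 0))"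
  proof (rule cf_cong_AE)
    show "path_functional (\<lambda>f. ?L (shrink (1/2) 1 f))"
      by (rule path_functional_shrink[OF pf1]) auto
    show "path_functional (\<lambda>f. \<Sum>i\<in>J. (if 1/2 < \<tau> i then c i / sqrt 2 else 0) * f (if 1/2 < \<tau> i then 2 * \<tau> i - 1 else 0))"
      by (rule path_functional_sum) (use \<tau> in auto)
    show "AE f in P 0 1. ?L (shrink (1/2) 1 f) = (\<Sum>i\<in>J. (if 1/2 < \<tau> i then c i / sqrt 2 else 0) * f (if 1/2 < \<tau> i then 2 * \<tau> i - 1 else 0))"
      using bd
    proof eventually_elim
      case (elim f)
      show ?case
      proof (rule sum.cong[OF refl])
        fix i assume i: "i \<in> J"
        show "c i * shrink (1/2) 1 f (\<tau> i) =
          (if 1/2 < \<tau> i then c i / sqrt 2 else 0) * f (if 1/2 < \<tau> i then 2 * \<tau> i - 1 else 0)"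
          using elim \<tau>[OF i] by (cases "\<tau> i = 1/2") (auto simp: shrink_def half mult.commute)
      qed
    qed
  qed
  finally show ?thesis by (simp add: mult_ac)
qed

text \<open>Cutting at 1/2 doubles the times within each half and lowers the level by one, down to
  the endpoints, where the path vanishes. Times form a family \<open>\<tau>\<close> over
  \<open>J\<close> rather than a set because the doubled times need not be distinct.\<close>

lemma cf_dyadic:
  assumes w: "\<And>u. cf (\<lambda>f. u * f (1/2)) = complex_of_real (exp (- w * u\<^sup>2 / 8))"
    and J: "finite J" and \<tau>: "\<And>i. i \<in> J \<Longrightarrow> \<tau> i \<in> {0..1}" "\<And>i. i \<in> J \<Longrightarrow> 2 ^ n * \<tau> i \<in> \<int>"
  shows "cf (\<lambda>f. \<Sum>i\<in>J. c i * f (\<tau> i))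
    = complex_of_real (exp (- w * (\<Sum>i\<in>J. \<Sum>j\<in>J. c i * c j * bb_cov 0 1 (\<tau> i) (\<tau> j)) / 2))"
  using \<tau>
proof (induction n arbitrary: c \<tau>)
  case 0
  have 01: "\<tau> i = 0 \<or> \<tau> i = 1" if i: "i \<in> J" for i
  proof -
    obtain k :: int where k: "\<tau> i = of_int k" using 0(2)[OF i] by (auto elim: Ints_cases)
    then have "0 \<le> k" "k \<le> 1" using 0(1)[OF i] by auto
    then show ?thesis using k by (cases "k = 0") auto
  qed
  have "cf (\<lambda>f. \<Sum>i\<in>J. c i * f (\<tau> i)) = cf (\<lambda>f. 0 * f 0)"
  proof (rule cf_cong_AE)
    have "AE f in P 0 1. f 0 = 0 \<and> f 1 = 0" by (rule boundary) simp
    then show "AE f in P 0 1. (\<Sum>i\<in>J. c i * f (\<tau> i)) = 0 * f 0"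
    proof eventually_elim
      case (elim f)
      then have "c i * f (\<tau> i) = 0" if "i \<in> J" for i using 01[OF that] by auto
      then show ?case by (simp only: mult_zero_left) (intro sum.neutral ballI)
    qed
  qed (use path_functional_sum[OF 0(1)] path_functional_coord[of 0 0] in auto)
  also have "\<dots> = 1" by (simp add: cf_def unit.prob_space)
  also have "(\<Sum>i\<in>J. \<Sum>j\<in>J. c i * c j * bb_cov 0 1 (\<tau> i) (\<tau> j)) = 0"
  proof (intro sum.neutral ballI)
    fix i j assume "i \<in> J" "j \<in> J"
    then show "c i * c j * bb_cov 0 1 (\<tau> i) (\<tau> j) = 0"
      using 01[of i] 01[of j] by (auto simp: bb_cov_01)
  qed
  then have "1 = complex_of_real (exp (- w * (\<Sum>i\<in>J. \<Sum>j\<in>J. c i * c j * bb_cov 0 1 (\<tau> i) (\<tau> j)) / 2))"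
    by simp
  finally show ?case .
next
  case (Suc n)
  let ?cl = "\<lambda>i. if \<tau> i \<le> 1/2 then c i / sqrt 2 else 0"
  let ?tl = "\<lambda>i. if \<tau> i \<le> 1/2 then 2 * \<tau> i else 0"
  let ?cr = "\<lambda>i. if 1/2 < \<tau> i then c i / sqrt 2 else 0"
  let ?tr = "\<lambda>i. if 1/2 < \<tau> i then 2 * \<tau> i - 1 else 0"
  define A where "A = (\<Sum>i\<in>J. c i * tent (\<tau> i))"
  define Ql where "Ql = (\<Sum>i\<in>J. \<Sum>j\<in>J. ?cl i * ?cl j * bb_cov 0 1 (?tl i) (?tl j))"
  define Qr where "Qr = (\<Sum>i\<in>J. \<Sum>j\<in>J. ?cr i * ?cr j * bb_cov 0 1 (?tr i) (?tr j))"
  have L: "cf (\<lambda>f. \<Sum>i\<in>J. ?cl i * f (?tl i)) = complex_of_real (exp (- w * Ql / 2))"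
    unfolding Ql_def
  proof (rule Suc.IH)
    show "?tl i \<in> {0..1}" if "i \<in> J" for i using Suc.prems(1)[OF that] by auto
    show "2 ^ n * ?tl i \<in> \<int>" if "i \<in> J" for i using Suc.prems(2)[OF that] by (simp add: mult.assoc mult.left_commute)
  qed
  have R: "cf (\<lambda>f. \<Sum>i\<in>J. ?cr i * f (?tr i)) = complex_of_real (exp (- w * Qr / 2))"
    unfolding Qr_def
  proof (rule Suc.IH)
    show "?tr i \<in> {0..1}" if "i \<in> J" for i using Suc.prems(1)[OF that] by auto
    show "2 ^ n * ?tr i \<in> \<int>" if "i \<in> J" for i
    proof -
      have "2 ^ n * (2 * \<tau> i) - 2 ^ n \<in> \<int>"
        using Suc.prems(2)[OF that] by (intro Ints_diff) (simp_all add: mult.assoc mult.left_commute)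
      then show ?thesis by (simp add: right_diff_distrib)
    qed
  qed
  have "(\<Sum>i\<in>J. \<Sum>j\<in>J. c i * c j * bb_cov 0 1 (\<tau> i) (\<tau> j))
     = (\<Sum>i\<in>J. \<Sum>j\<in>J. (c i * tent (\<tau> i)) * (c j * tent (\<tau> j)) / 4
         + ?cl i * ?cl j * bb_cov 0 1 (?tl i) (?tl j) + ?cr i * ?cr j * bb_cov 0 1 (?tr i) (?tr j))"
  proof (intro sum.cong refl)
    fix i j assume ij: "i \<in> J" "j \<in> J"
    have "sqrt 2 * sqrt 2 = (2::real)" by simp
    then show "c i * c j * bb_cov 0 1 (\<tau> i) (\<tau> j) = (c i * tent (\<tau> i)) * (c j * tent (\<tau> j)) / 4
         + ?cl i * ?cl j * bb_cov 0 1 (?tl i) (?tl j) + ?cr i * ?cr j * bb_cov 0 1 (?tr i) (?tr j)"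
      unfolding bb_cov_midpoint[OF Suc.prems(1)[OF ij(1)] Suc.prems(1)[OF ij(2)]]
      by (auto simp: algebra_simps)
  qed
  also have "\<dots> = A\<^sup>2 / 4 + Ql + Qr"
    unfolding A_def Ql_def Qr_def power2_eq_square sum_product by (simp add: sum.distrib sum_divide_distrib)
  finally have Q: "(\<Sum>i\<in>J. \<Sum>j\<in>J. c i * c j * bb_cov 0 1 (\<tau> i) (\<tau> j)) = A\<^sup>2 / 4 + Ql + Qr" .
  have "cf (\<lambda>f. \<Sum>i\<in>J. c i * f (\<tau> i)) = cf (\<lambda>f. A * f (1/2))
      * cf (\<lambda>f. \<Sum>i\<in>J. ?cl i * f (?tl i)) * cf (\<lambda>f. \<Sum>i\<in>J. ?cr i * f (?tr i))"
    unfolding A_def by (rule cf_split_half[OF J]) (rule Suc.prems(1))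
  also have "\<dots> = complex_of_real (exp (- w * A\<^sup>2 / 8)) * complex_of_real (exp (- w * Ql / 2))
      * complex_of_real (exp (- w * Qr / 2))"
    by (simp only: L R w)
  also have "\<dots> = complex_of_real (exp (- w * (A\<^sup>2 / 4 + Ql + Qr) / 2))"
    by (simp add: algebra_simps add_divide_distrib flip: of_real_mult exp_add)
  finally show ?case unfolding Q .
qed

section \<open>Passage from dyadic to arbitrary times\<close>

lemma coord_tendsto:
  assumes t: "t \<in> {0..1}" and s: "\<And>n. s n \<in> {0..1}" and lim: "s \<longlonglongrightarrow> t"
  shows "(\<lambda>n. \<integral>f. min 2 \<bar>c * (f (s n) - f t)\<bar> \<partial>P 0 1) \<longlonglongrightarrow> 0"
proof (rule LIMSEQ_I)
  fix e :: real assume e: "e > 0"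
  \<comment> \<open>Deviations up to \<open>\<epsilon>\<close> cost less than \<open>e / 2\<close>,
    larger ones at most twice a probability below \<open>e / 4\<close>; the added 1 avoids division
    by 0.\<close>
  define \<epsilon> where "\<epsilon> = e / (2 * (\<bar>c\<bar> + 1))"
  have \<epsilon>: "\<epsilon> > 0" using e by (simp add: \<epsilon>_def)
  have ce: "\<bar>c\<bar> * \<epsilon> < e / 2"
  proof -
    have "\<bar>c\<bar> * \<epsilon> < (\<bar>c\<bar> + 1) * \<epsilon>" using \<epsilon> by simp
    also have "\<dots> = e / 2" by (simp add: \<epsilon>_def field_simps)
    finally show ?thesis .
  qed
  define F where "F x = measure (P 0 1) {f \<in> space (P 0 1). \<epsilon> < \<bar>f t - f x\<bar>}" for x
  have Ft: "F t = 0" using \<epsilon> by (simp add: F_def)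
  \<comment> \<open>The limit in \<open>stoch_cont\<close> ignores the point \<open>t\<close>
    itself; since \<open>F t = 0\<close> it amounts to continuity, which also covers sequences that
    hit \<open>t\<close>.\<close>
  have "continuous (at t within {0..1}) F"
    using stoch_cont[of 0 1 t \<epsilon>] t \<epsilon> unfolding continuous_within Ft by (simp add: F_def[abs_def])
  then have "(\<lambda>n. F (s n)) \<longlonglongrightarrow> F t"
    by (rule continuous_within_tendsto_compose) (use s lim in auto)
  then obtain N where N: "\<And>n. n \<ge> N \<Longrightarrow> \<bar>F (s n)\<bar> < e / 4"
    using LIMSEQ_D[of "\<lambda>n. F (s n)" 0 "e/4"] e Ft by auto
  show "\<exists>no. \<forall>n\<ge>no. norm ((\<integral>f. min 2 \<bar>c * (f (s n) - f t)\<bar> \<partial>P 0 1) - 0) < e"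
  proof (intro exI allI impI)
    fix n assume n: "n \<ge> N"
    let ?A = "{f \<in> space (P 0 1). \<epsilon> < \<bar>f t - f (s n)\<bar>}"
    have [measurable]: "(\<lambda>f. f t) \<in> borel_measurable (P 0 1)" "(\<lambda>f. f (s n)) \<in> borel_measurable (P 0 1)"
      using t s by (auto intro!: measurable_coord)
    have "(\<integral>f. min 2 \<bar>c * (f (s n) - f t)\<bar> \<partial>P 0 1) \<le> (\<integral>f. \<bar>c\<bar> * \<epsilon> + 2 * indicator ?A f \<partial>P 0 1)"
    proof (rule integral_mono)
      show "integrable (P 0 1) (\<lambda>f. min 2 \<bar>c * (f (s n) - f t)\<bar>)"
        by (rule unit.integrable_const_bound[where B=2]) auto
      show "integrable (P 0 1) (\<lambda>f. \<bar>c\<bar> * \<epsilon> + 2 * indicator ?A f)"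
        by (rule unit.integrable_const_bound[where B="\<bar>c\<bar> * \<epsilon> + 2"]) (use \<epsilon> in \<open>auto simp: indicator_def\<close>)
      fix f assume f: "f \<in> space (P 0 1)"
      show "min 2 \<bar>c * (f (s n) - f t)\<bar> \<le> \<bar>c\<bar> * \<epsilon> + 2 * indicator ?A f"
      proof (cases "\<epsilon> < \<bar>f t - f (s n)\<bar>")
        case False
        then have "\<bar>c\<bar> * \<bar>f (s n) - f t\<bar> \<le> \<bar>c\<bar> * \<epsilon>" by (intro mult_left_mono) auto
        then show ?thesis using False by (simp add: abs_mult min_le_iff_disj indicator_def)
      qed (use f \<epsilon> in \<open>simp add: min_le_iff_disj\<close>)
    qed
    also have "\<dots> = \<bar>c\<bar> * \<epsilon> + 2 * F (s n)"
    proof -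
      have "integrable (P 0 1) (indicator ?A :: _ \<Rightarrow> real)"
        by (rule unit.integrable_const_bound[where B=1]) (auto simp: indicator_def)
      then show ?thesis
        by (subst Bochner_Integration.integral_add) (auto simp: F_def unit.prob_space)
    qed
    also have "\<dots> < e" using N[OF n] ce by auto
    finally have "(\<integral>f. min 2 \<bar>c * (f (s n) - f t)\<bar> \<partial>P 0 1) < e" .
    moreover have "(\<integral>f. min 2 \<bar>c * (f (s n) - f t)\<bar> \<partial>P 0 1) \<ge> 0" by (rule integral_nonneg_AE) auto
    ultimately show "norm ((\<integral>f. min 2 \<bar>c * (f (s n) - f t)\<bar> \<partial>P 0 1) - 0) < e" by simp
  qed
qed

lemma cf_tendsto:
  assumes J: "finite J" and \<tau>: "\<And>i. i \<in> J \<Longrightarrow> \<tau> i \<in> {0..1}"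
    and s: "\<And>n i. i \<in> J \<Longrightarrow> s n i \<in> {0..1}" and lim: "\<And>i. i \<in> J \<Longrightarrow> (\<lambda>n. s n i) \<longlonglongrightarrow> \<tau> i"
  shows "(\<lambda>n. cf (\<lambda>f. \<Sum>i\<in>J. c i * f (s n i))) \<longlonglongrightarrow> cf (\<lambda>f. \<Sum>i\<in>J. c i * f (\<tau> i))"
proof -
  let ?d = "\<lambda>n i f. min 2 \<bar>c i * (f (s n i) - f (\<tau> i))\<bar>"
  have "(\<lambda>n. \<Sum>i\<in>J. \<integral>f. ?d n i f \<partial>P 0 1) \<longlonglongrightarrow> (\<Sum>i\<in>J. 0)"
    using \<tau> s lim by (intro tendsto_sum coord_tendsto) auto
  then have lim0: "(\<lambda>n. \<Sum>i\<in>J. \<integral>f. ?d n i f \<partial>P 0 1) \<longlonglongrightarrow> 0" by simp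
  have "(\<lambda>n. cf (\<lambda>f. \<Sum>i\<in>J. c i * f (s n i)) - cf (\<lambda>f. \<Sum>i\<in>J. c i * f (\<tau> i))) \<longlonglongrightarrow> 0"
  proof (rule Lim_null_comparison[OF always_eventually lim0], rule allI)
    fix n
    have [measurable]: "(\<lambda>f. f (s n i)) \<in> borel_measurable (P 0 1)" "(\<lambda>f. f (\<tau> i)) \<in> borel_measurable (P 0 1)" if "i \<in> J" for i
      using \<tau> s that by (auto intro!: measurable_coord)
    have int: "integrable (P 0 1) (\<lambda>f. iexp (\<Sum>i\<in>J. c i * f (s n i)))" "integrable (P 0 1) (\<lambda>f. iexp (\<Sum>i\<in>J. c i * f (\<tau> i)))"
      by (auto intro!: unit.integrable_iexp)
    have intd: "integrable (P 0 1) (?d n i)" if "i \<in> J" for i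
      by (rule unit.integrable_const_bound[where B=2]) (use that in auto)
    have "cmod (cf (\<lambda>f. \<Sum>i\<in>J. c i * f (s n i)) - cf (\<lambda>f. \<Sum>i\<in>J. c i * f (\<tau> i)))
      = cmod (CLINT f|P 0 1. iexp (\<Sum>i\<in>J. c i * f (s n i)) - iexp (\<Sum>i\<in>J. c i * f (\<tau> i)))"
      unfolding cf_def by (subst Bochner_Integration.integral_diff[OF int]) simp
    also have "\<dots> \<le> (\<integral>f. cmod (iexp (\<Sum>i\<in>J. c i * f (s n i)) - iexp (\<Sum>i\<in>J. c i * f (\<tau> i))) \<partial>P 0 1)"
      by (rule integral_norm_bound)
    also have "\<dots> \<le> (\<integral>f. (\<Sum>i\<in>J. ?d n i f) \<partial>P 0 1)"
    proof (rule integral_mono)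
      show "integrable (P 0 1) (\<lambda>f. cmod (iexp (\<Sum>i\<in>J. c i * f (s n i)) - iexp (\<Sum>i\<in>J. c i * f (\<tau> i))))"
        using int by (intro integrable_norm Bochner_Integration.integrable_diff)
      show "integrable (P 0 1) (\<lambda>f. \<Sum>i\<in>J. ?d n i f)"
        using intd by (rule Bochner_Integration.integrable_sum)
      fix f
      have "cmod (iexp (\<Sum>i\<in>J. c i * f (s n i)) - iexp (\<Sum>i\<in>J. c i * f (\<tau> i)))
         \<le> min 2 \<bar>(\<Sum>i\<in>J. c i * f (s n i)) - (\<Sum>i\<in>J. c i * f (\<tau> i))\<bar>" by (rule norm_iexp_diff_le)
      also have "(\<Sum>i\<in>J. c i * f (s n i)) - (\<Sum>i\<in>J. c i * f (\<tau> i)) = (\<Sum>i\<in>J. c i * (f (s n i) - f (\<tau> i)))"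
        by (simp add: right_diff_distrib sum_subtractf)
      also have "min 2 \<bar>\<dots>\<bar> \<le> (\<Sum>i\<in>J. ?d n i f)" by (rule min_sum_le[OF J])
      finally show "cmod (iexp (\<Sum>i\<in>J. c i * f (s n i)) - iexp (\<Sum>i\<in>J. c i * f (\<tau> i))) \<le> (\<Sum>i\<in>J. ?d n i f)" .
    qed
    also have "\<dots> = (\<Sum>i\<in>J. \<integral>f. ?d n i f \<partial>P 0 1)"
      using intd by (rule Bochner_Integration.integral_sum)
    finally show "cmod (cf (\<lambda>f. \<Sum>i\<in>J. c i * f (s n i)) - cf (\<lambda>f. \<Sum>i\<in>J. c i * f (\<tau> i))) \<le> (\<Sum>i\<in>J. \<integral>f. ?d n i f \<partial>P 0 1)" .
  qed
  then show ?thesis by (simp add: LIM_zero_iff)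
qed

lemma cf_gauss:
  assumes w: "\<And>u. cf (\<lambda>f. u * f (1/2)) = complex_of_real (exp (- w * u\<^sup>2 / 8))"
    and J: "finite J" and \<tau>: "\<And>i. i \<in> J \<Longrightarrow> \<tau> i \<in> {0..1}"
  shows "cf (\<lambda>f. \<Sum>i\<in>J. c i * f (\<tau> i))
    = complex_of_real (exp (- w * (\<Sum>i\<in>J. \<Sum>j\<in>J. c i * c j * bb_cov 0 1 (\<tau> i) (\<tau> j)) / 2))"
proof -
  \<comment> \<open>Rounding down to the grid of level \<open>n\<close> stays in the unit interval,
    since 0 is a grid point.\<close>
  define s :: "nat \<Rightarrow> _ \<Rightarrow> real" where "s n i = of_int \<lfloor>2 ^ n * \<tau> i\<rfloor> / 2 ^ n" for n :: nat and i
  have fl: "2 ^ n * \<tau> i - 1 \<le> of_int \<lfloor>2 ^ n * \<tau> i\<rfloor>" "of_int \<lfloor>2 ^ n * \<tau> i\<rfloor> \<le> 2 ^ n * \<tau> i" for n i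
    by linarith+
  have s_le: "s n i \<le> \<tau> i" for n i
    using fl[of n i] by (simp add: s_def field_simps)
  have s_ge: "\<tau> i - (1/2) ^ n \<le> s n i" for n i
  proof -
    have "\<tau> i - (1/2) ^ n = (2 ^ n * \<tau> i - 1) / 2 ^ n" by (simp add: power_one_over field_simps)
    then show ?thesis unfolding s_def using fl[of n i] by (simp add: divide_right_mono)
  qed
  have s01: "s n i \<in> {0..1}" if "i \<in> J" for n i
  proof -
    have "0 \<le> s n i" using \<tau>[OF that] by (simp add: s_def)
    then show ?thesis using \<tau>[OF that] s_le[of n i] by auto
  qed
  have lim: "(\<lambda>n. s n i) \<longlonglongrightarrow> \<tau> i" for i
  proof (rule tendsto_sandwich[OF always_eventually always_eventually _ tendsto_const])
    show "\<forall>n. \<tau> i - (1/2) ^ n \<le> s n i" "\<forall>n. s n i \<le> \<tau> i" using s_le s_ge by auto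
    have "(\<lambda>n. \<tau> i - (1/2) ^ n) \<longlonglongrightarrow> \<tau> i - 0"
      by (intro tendsto_diff tendsto_const LIMSEQ_realpow_zero) auto
    then show "(\<lambda>n. \<tau> i - (1/2) ^ n) \<longlonglongrightarrow> \<tau> i" by simp
  qed
  have dy: "cf (\<lambda>f. \<Sum>i\<in>J. c i * f (s n i))
    = complex_of_real (exp (- w * (\<Sum>i\<in>J. \<Sum>j\<in>J. c i * c j * bb_cov 0 1 (s n i) (s n j)) / 2))" for n
    by (rule cf_dyadic[where n=n, OF w J s01]) (auto simp: s_def)
  have "(\<lambda>n. cf (\<lambda>f. \<Sum>i\<in>J. c i * f (s n i))) \<longlonglongrightarrow> cf (\<lambda>f. \<Sum>i\<in>J. c i * f (\<tau> i))"
    by (rule cf_tendsto[OF J \<tau> s01 lim])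
  moreover have "(\<lambda>n. complex_of_real (exp (- w * (\<Sum>i\<in>J. \<Sum>j\<in>J. c i * c j * bb_cov 0 1 (s n i) (s n j)) / 2)))
     \<longlonglongrightarrow> complex_of_real (exp (- w * (\<Sum>i\<in>J. \<Sum>j\<in>J. c i * c j * bb_cov 0 1 (\<tau> i) (\<tau> j)) / 2))"
    unfolding bb_cov_01 by (intro tendsto_intros lim) auto
  ultimately show ?thesis unfolding dy by (intro LIMSEQ_unique)
qed

section \<open>Transfer to arbitrary intervals\<close>

lemma char_P:
  assumes w: "\<And>u. cf (\<lambda>f. u * f (1/2)) = complex_of_real (exp (- w * u\<^sup>2 / 8))"
    and ab: "a \<le> b" and J: "finite J" "J \<subseteq> {a..b}"
  shows "(CLINT f|P a b. iexp (\<Sum>t\<in>J. c t * f t))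
    = complex_of_real (exp (- w * (\<Sum>s\<in>J. \<Sum>t\<in>J. c s * c t * bb_cov a b s t) / 2))"
proof -
  have [measurable]: "(\<lambda>f. f t) \<in> borel_measurable (path_space a b)" if "t \<in> J" for t
    using that J(2) by (intro measurable_component_singleton) auto
  have "(CLINT f|P a b. iexp (\<Sum>t\<in>J. c t * f t))
      = (CLINT f|P 0 1. iexp (\<Sum>t\<in>J. c t * rescale a b f t))"
    unfolding P_eq_rescale[OF ab] by (rule integral_distr[OF measurable_rescale[OF ab]]) measurable
  also have "\<dots> = cf (\<lambda>f. \<Sum>t\<in>J. (c t * sqrt (b - a)) * f ((t - a) / (b - a)))"
    unfolding cf_def using J(2)
    by (intro Bochner_Integration.integral_cong refl arg_cong[where f=iexp] sum.cong) (auto simp: subset_iff)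
  also have "\<dots> = complex_of_real (exp (- w * (\<Sum>s\<in>J. \<Sum>t\<in>J. (c s * sqrt (b - a)) * (c t * sqrt (b - a)) *
         bb_cov 0 1 ((s - a) / (b - a)) ((t - a) / (b - a))) / 2))"
    using J(2) by (intro cf_gauss[OF w J(1)] rescale_in_unit[OF ab]) auto
  also have "(\<Sum>s\<in>J. \<Sum>t\<in>J. (c s * sqrt (b - a)) * (c t * sqrt (b - a)) *
         bb_cov 0 1 ((s - a) / (b - a)) ((t - a) / (b - a))) = (\<Sum>s\<in>J. \<Sum>t\<in>J. c s * c t * bb_cov a b s t)"
    by (simp only: bb_cov_rescale_sqrt[OF ab])
  finally show ?thesis .
qed

theorem P_eq_scaled_brownian_bridge:
  "\<exists>\<sigma>::real. \<sigma> \<ge> 0 \<and> (\<forall>a b. a \<le> b \<longrightarrow>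
     (\<exists>B. brownian_bridge_law a b B \<and>
          P a b = distr B (path_space a b) (\<lambda>f. restrict (\<lambda>t. \<sigma> * f t) {a..b})))"
proof -
  obtain w where w0: "w \<ge> 0" and w: "\<And>u. cf (\<lambda>f. u * f (1/2)) = complex_of_real (exp (- w * u\<^sup>2 / 8))"
    using cf_midpoint_gauss by auto
  define \<sigma> where "\<sigma> = sqrt w"
  have mscale: "(\<lambda>f. restrict (\<lambda>t. x * f t) {a..b}) \<in> measurable (path_space a b) (path_space a b)" for x a b :: real
    by (rule measurable_restrict) (auto intro!: borel_measurable_times measurable_component_singleton)
  have "\<exists>B. brownian_bridge_law a b B \<and>
          P a b = distr B (path_space a b) (\<lambda>f. restrict (\<lambda>t. \<sigma> * f t) {a..b})" if ab: "a \<le> b" for a b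
  proof (cases "w = 0")
    case True
    \<comment> \<open>With \<open>\<sigma> = 0\<close> the law \<open>P a b\<close> cannot be
      normalised; any bridge serves, as both sides become the law of the null path.\<close>
    obtain B where B: "brownian_bridge_law a b B" using brownian_bridge_exists[OF ab] by auto
    then interpret B: prob_space B by (simp add: brownian_bridge_law_def)
    interpret I: prob_space "P a b" using laws[OF ab] by simp
    have mB: "(\<lambda>f. restrict (\<lambda>t. \<sigma> * f t) {a..b}) \<in> measurable B (path_space a b)"
      using B mscale[of \<sigma> a b] by (simp add: brownian_bridge_law_def measurable_cong_sets[of B "path_space a b" _ "path_space a b"])
    have "P a b = distr B (path_space a b) (\<lambda>f. restrict (\<lambda>t. \<sigma> * f t) {a..b})"
    proof (rule path_measure_eqI_AE_zero)
      fix t assume t: "t \<in> {a..b}"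
      show "AE f in distr B (path_space a b) (\<lambda>f. restrict (\<lambda>t. \<sigma> * f t) {a..b}). f t = 0"
        using t True by (subst AE_distr_iff[OF mB]) (auto simp: \<sigma>_def intro!: measurable_component_singleton)
      have mt[measurable]: "(\<lambda>f. f t) \<in> borel_measurable (P a b)" by (rule measurable_coord[OF ab t])
      have "char (distr (P a b) borel (\<lambda>f. f t)) u = char (return borel 0) u" for u
        using char_P[OF w ab, of "{t}" "\<lambda>_. u"] t True by (simp add: char_def integral_distr integral_return)
      then have "distr (P a b) borel (\<lambda>f. f t) = return borel 0"
        by (intro Levy_uniqueness I.real_distribution_distr mt)
          (auto simp: real_distribution_def real_distribution_axioms_def intro!: prob_space_return)
      moreover have "AE x in return borel (0::real). x = 0" by (simp add: AE_return)
      ultimately have "AE x in distr (P a b) borel (\<lambda>f. f t). x = 0" by (simp only:)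
      then show "AE f in P a b. f t = 0" by (subst (asm) AE_distr_iff) auto
    qed (use laws[OF ab] B.prob_space_distr[OF mB] in auto)
    then show ?thesis using B by auto
  next
    case False
    then have \<sigma>: "\<sigma> > 0" "\<sigma>\<^sup>2 = w" using w0 by (auto simp: \<sigma>_def)
    interpret I: prob_space "P a b" using laws[OF ab] by simp
    let ?B = "distr (P a b) (path_space a b) (\<lambda>f. restrict (\<lambda>t. (1 / \<sigma>) * f t) {a..b})"
    have m: "(\<lambda>f. restrict (\<lambda>t. (1 / \<sigma>) * f t) {a..b}) \<in> measurable (P a b) (path_space a b)"
      unfolding measurable_P[OF ab] by (rule mscale)
    have "brownian_bridge_law a b ?B"
    proof (rule brownian_bridge_lawI)
      show "prob_space ?B" by (rule I.prob_space_distr[OF m])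
      fix J :: "real set" and c :: "real \<Rightarrow> real"
      assume J: "finite J" "J \<subseteq> {a..b}"
      have [measurable]: "(\<lambda>f. f t) \<in> borel_measurable (path_space a b)" if "t \<in> J" for t
        using that J(2) by (intro measurable_component_singleton) auto
      have "(CLINT f|?B. iexp (\<Sum>t\<in>J. c t * f t)) = (CLINT f|P a b. iexp (\<Sum>t\<in>J. c t * restrict (\<lambda>t. (1 / \<sigma>) * f t) {a..b} t))"
        by (rule integral_distr[OF m]) measurable
      also have "\<dots> = (CLINT f|P a b. iexp (\<Sum>t\<in>J. (c t / \<sigma>) * f t))"
        using J(2) by (intro Bochner_Integration.integral_cong refl arg_cong[where f=iexp] sum.cong) (auto simp: subset_iff)
      also have "\<dots> = complex_of_real (exp (- (w * (\<Sum>s\<in>J. \<Sum>t\<in>J. (c s / \<sigma>) * (c t / \<sigma>) * bb_cov a b s t)) / 2))"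
        unfolding minus_mult_left by (rule char_P[OF w ab J])
      also have "w * (\<Sum>s\<in>J. \<Sum>t\<in>J. (c s / \<sigma>) * (c t / \<sigma>) * bb_cov a b s t) = (\<Sum>s\<in>J. \<Sum>t\<in>J. c s * c t * bb_cov a b s t)"
      proof -
        have "(\<Sum>s\<in>J. \<Sum>t\<in>J. (c s / \<sigma>) * (c t / \<sigma>) * bb_cov a b s t) = (\<Sum>s\<in>J. \<Sum>t\<in>J. c s * c t * bb_cov a b s t) / w"
          unfolding \<sigma>(2)[symmetric] by (simp add: sum_divide_distrib power2_eq_square)
        then show ?thesis using False by simp
      qed
      finally show "(CLINT f|?B. iexp (\<Sum>t\<in>J. c t * f t))
        = complex_of_real (exp (- (\<Sum>s\<in>J. \<Sum>t\<in>J. c s * c t * bb_cov a b s t) / 2))" .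
    qed simp
    moreover have "P a b = distr ?B (path_space a b) (\<lambda>f. restrict (\<lambda>t. \<sigma> * f t) {a..b})"
    proof -
      have "distr ?B (path_space a b) (\<lambda>f. restrict (\<lambda>t. \<sigma> * f t) {a..b})
        = distr (P a b) (path_space a b) ((\<lambda>f. restrict (\<lambda>t. \<sigma> * f t) {a..b}) \<circ> (\<lambda>f. restrict (\<lambda>t. (1 / \<sigma>) * f t) {a..b}))"
        by (rule distr_distr[OF mscale m])
      \<comment> \<open>Scaling by \<open>1 / \<sigma>\<close> and back, with the restrictions, is
        the identity on extensional functions only, and these make up
        \<open>space (P a b)\<close>.\<close>
      also have "\<dots> = distr (P a b) (path_space a b) (\<lambda>f. f)"
      proof (rule distr_cong[OF refl refl])
        fix f assume "f \<in> space (P a b)"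
        then have "f \<in> extensional {a..b}"
          using sets_eq_imp_space_eq[OF sets_P[OF ab]] by (auto simp: space_PiM PiE_def)
        then show "((\<lambda>f. restrict (\<lambda>t. \<sigma> * f t) {a..b}) \<circ> (\<lambda>f. restrict (\<lambda>t. (1 / \<sigma>) * f t) {a..b})) f = f"
          using \<sigma>(1) by (intro ext) (auto simp: restrict_def extensional_def)
      qed
      also have "\<dots> = P a b" by (rule distr_id2) (simp add: sets_P[OF ab])
      finally show ?thesis by simp
    qed
    ultimately show ?thesis by blast
  qed
  then show ?thesis using w0 by (intro exI[of _ \<sigma>]) (auto simp: \<sigma>_def)
qed

end

theorem theorem1p9:
  fixes P :: "real \<Rightarrow> real \<Rightarrow> (real \<Rightarrow> real) measure"
  assumes laws: "\<And>a b. a \<le> b \<Longrightarrow> prob_space (P a b) \<and> sets (P a b) = sets (path_space a b)"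
    and tails: "\<And>a b t. a \<le> b \<Longrightarrow> t \<in> {a..b} \<Longrightarrow>
                  integrable (P a b) (\<lambda>f. log_plus \<bar>f t\<bar>)"
    and stoch_cont: "\<And>a b t \<epsilon>. a \<le> b \<Longrightarrow> t \<in> {a..b} \<Longrightarrow> \<epsilon> > 0 \<Longrightarrow>
                  ((\<lambda>s. measure (P a b) {f \<in> space (P a b). \<epsilon> < \<bar>f t - f s\<bar>}) \<longlongrightarrow> 0)
                    (at t within {a..b})"
    and boundary: "\<And>a b. a \<le> b \<Longrightarrow> AE f in P a b. f a = 0 \<and> f b = 0"
    and markov: "\<And>a b c d. c \<le> a \<Longrightarrow> a \<le> b \<Longrightarrow> b \<le> d \<Longrightarrow>
                  P c d = distr (P c d \<Otimes>\<^sub>M P a b) (path_space c d)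
                    (\<lambda>(f, g). restrict (\<lambda>s. if s \<in> {a..b} then lin_interp f a b s + g s else f s) {c..d})"
    and transl: "\<And>a b x. a \<le> b \<Longrightarrow>
                  distr (P (a - x) (b - x)) (path_space a b) (\<lambda>f. restrict (\<lambda>t. f (t - x)) {a..b}) = P a b"
    and scaling: "\<And>a b c. a \<le> b \<Longrightarrow> c > 0 \<Longrightarrow>
                  distr (P (c * a) (c * b)) (path_space a b)
                    (\<lambda>f. restrict (\<lambda>t. f (c * t) / sqrt c) {a..b}) = P a b"
  shows "\<exists>\<sigma>::real. \<sigma> \<ge> 0 \<and> (\<forall>a b. a \<le> b \<longrightarrow>
           (\<exists>B. brownian_bridge_law a b B \<and>
                P a b = distr B (path_space a b) (\<lambda>f. restrict (\<lambda>t. \<sigma> * f t) {a..b})))"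
proof -
  interpret bridge_family P
    by standard (fact laws stoch_cont boundary markov transl scaling)+
  show ?thesis by (rule P_eq_scaled_brownian_bridge)
qed

end
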